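(* Let $\mathbf{A}$ be a strongly Fregean algebra. Then $\mathcal{H}(\mathbf{A})$ is closed under the equivalence operation $\leftrightarrow$ of the Heyting algebra $Up(\mathsf{Cm}(\mathbf{A}))$.
   Context: Conventions. $\mathsf{Con}(\mathbf{A})$ is the congruence lattice of an algebra $\mathbf{A}$ (congruences are subsets of $A^2$). $\mathsf{Cm}(\mathbf{A})$ is the set of completely meet irreducible congruences; for $\eta\in\mathsf{Cm}(\mathbf{A})$, $\eta^{+}$ denotes the least congruence strictly greater than $\eta$. For $\alpha\le\beta$ in $\mathsf{Con}(\mathbf{A})$ let $I[\alpha,\beta]=\{\gamma:\alpha\le\gamma\le\beta\}$. Write $I[\alpha,\beta]\nearrow I[\gamma,\delta]$ (equivalently $I[\gamma,\delta]\searrow I[\alpha,\beta]$) if $\beta\wedge\gamma=\alpha$ and $\beta\vee\gamma=\delta$. Two intervals are projective if they are connected by a finite sequence of steps $\nearrow,\searrow$. When $\mathsf{Con}(\mathbf{A})$ is modular, for $\varphi,\psi\in\mathsf{Cm}(\mathbf{A})$ put $\varphi\sim\psi$ iff $I[\varphi,\varphi^{+}]$ and $I[\psi,\psi^{+}]$ are projective; this is an equivalence relation. The language contains a distinguished constant term $1$. $\Theta_{\mathbf{A}}(c,d)$ is the least congruence containing $(c,d)$. $\mathbf{A}$ is congruence orderable if $\Theta_{\mathbf{A}}(1,a)=\Theta_{\mathbf{A}}(1,b)$ implies $a=b$ for $a,b\in A$; it is $1$-regular if $1/\alpha=1/\beta$ implies $\alpha=\beta$ for $\alpha,\beta\in\mathsf{Con}(\mathbf{A})$;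 it is Fregean if it is both. $\mathbf{A}$ is strongly Fregean if every homomorphic image of $\mathbf{A}$ is Fregean (with respect to $1$) and the variety generated by $\mathbf{A}$ is congruence modular. For strongly Fregean $\mathbf{A}$, $\varphi\sim\psi$ implies $\varphi^{+}=\psi^{+}$. For $U=\eta/\!\sim$ and $S\subset U$ put $\overline{S}:=S\cup\{\eta^{+}\}$ (independent of the choice of $\eta\in U$), and for $\varphi,\psi\in\overline{U}$ put $\varphi\bullet\psi:=(\varphi\div\psi)'\cap\eta^{+}$, where $\div$ is symmetric difference and $'$ is complement in $A^2$. Then $(\overline{U},\bullet)$ is a Boolean group (every element is its own inverse) with unit $\eta^{+}$, regarded as a vector space over $\mathbb{Z}_2$; "hyperplane" means a subspace of codimension $1$ (a maximal proper subgroup). $Up(\mathsf{Cm}(\mathbf{A}))$ is the Heyting algebra of upward closed subsets of the poset $(\mathsf{Cm}(\mathbf{A}),\le)$; its equivalence operation is $S\leftrightarrow T:=((S\div T)\downarrow)'$, where $X\!\downarrow\,=\{\mu\in\mathsf{Cm}(\mathbf{A}):\mu\le\varphi\text{ for some }\varphi\in X\}$ and $'$ is complement in $\mathsf{Cm}(\mathbf{A})$; equivalently, $S\leftrightarrow T$ is the largest $C\in Up(\mathsf{Cm}(\mathbf{A}))$ with $C\cap S=C\cap T$. For $U=\eta/\!\sim$ put $U^{+}:=\{\vartheta\in\mathsf{Cm}(\mathbf{A}):\vartheta\ge\eta^{+}\}$. A set $Z\subset\mathsf{Cm}(\mathbf{A})$ is hereditary if (I) $Z$ is upward closed, and (II)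 for all $U\in\mathsf{Cm}(\mathbf{A})/\!\sim$, if $U^{+}\subset Z$, then $\overline{Z\cap U}=\overline{U}$ or $\overline{Z\cap U}$ is a hyperplane in $(\overline{U},\bullet)$. $\mathcal{H}(\mathbf{A})$ is the set of all hereditary subsets of $\mathsf{Cm}(\mathbf{A})$. *)

theory Defs
  imports "HOL-Algebra.Group"
begin

text \<open>
  Algebras over a finitary signature \<open>ar :: 'f \<Rightarrow> nat\<close>, which assigns an arity to every operation
  symbol. The interpretation of a symbol matters only on argument lists of the right length
  with entries in the carrier.
\<close>

record ('f, 'a) ualg = "'a partial_object" +
  interp :: "'f \<Rightarrow> 'a list \<Rightarrow> 'a"

definition is_algebra :: "('f \<Rightarrow> nat) \<Rightarrow> ('f, 'a) ualg \<Rightarrow> bool" where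
  "is_algebra ar A \<longleftrightarrow> carrier A \<noteq> {} \<and>
     (\<forall>f xs. length xs = ar f \<and> set xs \<subseteq> carrier A \<longrightarrow> interp A f xs \<in> carrier A)"

definition hom_onto :: "('f \<Rightarrow> nat) \<Rightarrow> ('f, 'a) ualg \<Rightarrow> ('f, 'b) ualg \<Rightarrow> ('a \<Rightarrow> 'b) \<Rightarrow> bool" where
  "hom_onto ar A B h \<longleftrightarrow> h ` carrier A = carrier B \<and>
     (\<forall>f xs. length xs = ar f \<and> set xs \<subseteq> carrier A \<longrightarrow>
        h (interp A f xs) = interp B f (map h xs))"


section \<open>Terms, identities and generated varieties\<close>

datatype ('f, 'v) trm = Var 'v | Op 'f "('f, 'v) trm list"

fun wf_trm :: "('f \<Rightarrow> nat) \<Rightarrow> ('f, 'v) trm \<Rightarrow> bool" where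
  "wf_trm ar (Var x) \<longleftrightarrow> True"
| "wf_trm ar (Op f ts) \<longleftrightarrow> length ts = ar f \<and> (\<forall>t\<in>set ts. wf_trm ar t)"

fun trm_val :: "('f, 'a) ualg \<Rightarrow> ('v \<Rightarrow> 'a) \<Rightarrow> ('f, 'v) trm \<Rightarrow> 'a" where
  "trm_val A \<rho> (Var x) = \<rho> x"
| "trm_val A \<rho> (Op f ts) = interp A f (map (trm_val A \<rho>) ts)"

definition holds_in :: "('f, 'a) ualg \<Rightarrow> ('f, 'v) trm \<Rightarrow> ('f, 'v) trm \<Rightarrow> bool" where
  "holds_in A s t \<longleftrightarrow> (\<forall>\<rho>. range \<rho> \<subseteq> carrier A \<longrightarrow> trm_val A \<rho> s = trm_val A \<rho> t)"

text \<open>The variety generated by \<open>A\<close> is the class of all models of the identities of \<open>A\<close>.\<close>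

definition in_variety_of :: "('f \<Rightarrow> nat) \<Rightarrow> ('f, 'a) ualg \<Rightarrow> ('f, 'b) ualg \<Rightarrow> bool" where
  "in_variety_of ar A B \<longleftrightarrow> is_algebra ar B \<and>
     (\<forall>s t :: ('f, nat) trm.
        wf_trm ar s \<and> wf_trm ar t \<and> holds_in A s t \<longrightarrow> holds_in B s t)"

text \<open>
  A constant term is a term whose value does not depend on the valuation. It need not be
  closed: in equivalential algebras, for example, it is \<open>x \<leftrightarrow> x\<close>.
\<close>

definition constant_trm :: "('f \<Rightarrow> nat) \<Rightarrow> ('f, 'a) ualg \<Rightarrow> ('f, nat) trm \<Rightarrow> bool" where
  "constant_trm ar A t \<longleftrightarrow> wf_trm ar t \<and>
     (\<forall>\<rho> \<sigma>. range \<rho> \<subseteq> carrier A \<and> range \<sigma> \<subseteq> carrier A \<longrightarrow> trm_val A \<rho> t = trm_val A \<sigma> t)"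

definition const_val :: "('f, 'a) ualg \<Rightarrow> ('f, nat) trm \<Rightarrow> 'a" where
  "const_val A t = (THE c. \<forall>\<rho>. range \<rho> \<subseteq> carrier A \<longrightarrow> trm_val A \<rho> t = c)"


section \<open>Congruences\<close>

definition Con :: "('f \<Rightarrow> nat) \<Rightarrow> ('f, 'a) ualg \<Rightarrow> ('a \<times> 'a) set set" where
  "Con ar A = {\<theta>. equiv (carrier A) \<theta> \<and>
     (\<forall>f xs ys. length xs = ar f \<and> length ys = ar f \<and> (\<forall>i < ar f. (xs ! i, ys ! i) \<in> \<theta>) \<longrightarrow>
        (interp A f xs, interp A f ys) \<in> \<theta>)}"

text \<open>
  The order of the congruence lattice is inclusion and binary meets are intersections.
\<close>

definition con_join ::
    "('f \<Rightarrow> nat) \<Rightarrow> ('f, 'a) ualg \<Rightarrow> ('a \<times> 'a) set \<Rightarrow> ('a \<times> 'a) set \<Rightarrow> ('a \<times> 'a) set" where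
  "con_join ar A \<alpha> \<beta> = \<Inter>{\<gamma> \<in> Con ar A. \<alpha> \<subseteq> \<gamma> \<and> \<beta> \<subseteq> \<gamma>}"

definition modular_Con :: "('f \<Rightarrow> nat) \<Rightarrow> ('f, 'a) ualg \<Rightarrow> bool" where
  "modular_Con ar A \<longleftrightarrow> (\<forall>\<alpha>\<in>Con ar A. \<forall>\<beta>\<in>Con ar A. \<forall>\<gamma>\<in>Con ar A.
     \<alpha> \<subseteq> \<gamma> \<longrightarrow> con_join ar A \<alpha> (\<beta> \<inter> \<gamma>) = con_join ar A \<alpha> \<beta> \<inter> \<gamma>)"

text \<open>
  HOL cannot quantify over the algebras of all types at once, so the members of the variety are
  taken with carrier in the type of sets of terms over the variables \<open>'a + nat\<close>. Up to isomorphism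
  these include all members of the variety with a generating set that embeds into \<open>'a + nat\<close>
  (quotients of the term algebra), in particular \<open>A\<close>, its finite powers, and the free algebra on
  countably many generators. Congruence modularity of a variety is decided by its free algebra on
  four generators (Day), so nothing is lost.
\<close>

definition cong_modular_variety_of :: "('f \<Rightarrow> nat) \<Rightarrow> ('f, 'a) ualg \<Rightarrow> bool" where
  "cong_modular_variety_of ar A \<longleftrightarrow>
     (\<forall>B :: ('f, ('f, 'a + nat) trm set) ualg. in_variety_of ar A B \<longrightarrow> modular_Con ar B)"

definition principal_con :: "('f \<Rightarrow> nat) \<Rightarrow> ('f, 'a) ualg \<Rightarrow> 'a \<Rightarrow> 'a \<Rightarrow> ('a \<times> 'a) set" where
  "principal_con ar A c d = \<Inter>{\<gamma> \<in> Con ar A. (c, d) \<in> \<gamma>}"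


section \<open>Fregean algebras\<close>

definition cong_orderable :: "('f \<Rightarrow> nat) \<Rightarrow> ('f, nat) trm \<Rightarrow> ('f, 'a) ualg \<Rightarrow> bool" where
  "cong_orderable ar t A \<longleftrightarrow> (\<forall>a\<in>carrier A. \<forall>b\<in>carrier A.
     principal_con ar A (const_val A t) a = principal_con ar A (const_val A t) b \<longrightarrow> a = b)"

definition one_regular :: "('f \<Rightarrow> nat) \<Rightarrow> ('f, nat) trm \<Rightarrow> ('f, 'a) ualg \<Rightarrow> bool" where
  "one_regular ar t A \<longleftrightarrow> (\<forall>\<alpha>\<in>Con ar A. \<forall>\<beta>\<in>Con ar A.
     \<alpha> `` {const_val A t} = \<beta> `` {const_val A t} \<longrightarrow> \<alpha> = \<beta>)"

definition fregean :: "('f \<Rightarrow> nat) \<Rightarrow> ('f, nat) trm \<Rightarrow> ('f, 'a) ualg \<Rightarrow> bool" where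
  "fregean ar t A \<longleftrightarrow> cong_orderable ar t A \<and> one_regular ar t A"

text \<open>
  Every homomorphic image of \<open>A\<close> is isomorphic to a quotient of \<open>A\<close>, hence to one with carrier
  in the type \<open>'a set\<close>.
\<close>

definition strongly_fregean :: "('f \<Rightarrow> nat) \<Rightarrow> ('f, nat) trm \<Rightarrow> ('f, 'a) ualg \<Rightarrow> bool" where
  "strongly_fregean ar t A \<longleftrightarrow>
     (\<forall>(B :: ('f, 'a set) ualg) h. is_algebra ar B \<and> hom_onto ar A B h \<longrightarrow> fregean ar t B) \<and>
     cong_modular_variety_of ar A"


section \<open>Completely meet irreducible congruences and projectivity\<close>

text \<open>
  The meet of the empty family is the full congruence, which is therefore not completely
  meet irreducible.
\<close>

definition Cm :: "('f \<Rightarrow> nat) \<Rightarrow> ('f, 'a) ualg \<Rightarrow> ('a \<times> 'a) set set" where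
  "Cm ar A = {\<eta> \<in> Con ar A.
     \<forall>S \<subseteq> Con ar A. (carrier A \<times> carrier A) \<inter> \<Inter>S = \<eta> \<longrightarrow> \<eta> \<in> S}"

definition con_cover :: "('f \<Rightarrow> nat) \<Rightarrow> ('f, 'a) ualg \<Rightarrow> ('a \<times> 'a) set \<Rightarrow> ('a \<times> 'a) set" where
  "con_cover ar A \<eta> =
     (THE \<gamma>. \<gamma> \<in> Con ar A \<and> \<eta> \<subset> \<gamma> \<and> (\<forall>\<delta>\<in>Con ar A. \<eta> \<subset> \<delta> \<longrightarrow> \<gamma> \<subseteq> \<delta>))"

text \<open>The interval \<open>I[\<alpha>, \<beta>]\<close> is represented by the pair \<open>(\<alpha>, \<beta>)\<close> of its end points.\<close>

definition intervals :: "('f \<Rightarrow> nat) \<Rightarrow> ('f, 'a) ualg \<Rightarrow> (('a \<times> 'a) set \<times> ('a \<times> 'a) set) set" where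
  "intervals ar A = {(\<alpha>, \<beta>). \<alpha> \<in> Con ar A \<and> \<beta> \<in> Con ar A \<and> \<alpha> \<subseteq> \<beta>}"

definition transposes_up :: "('f \<Rightarrow> nat) \<Rightarrow> ('f, 'a) ualg \<Rightarrow>
    ((('a \<times> 'a) set \<times> ('a \<times> 'a) set) \<times> (('a \<times> 'a) set \<times> ('a \<times> 'a) set)) set" where
  "transposes_up ar A = {((\<alpha>, \<beta>), (\<gamma>, \<delta>)).
     (\<alpha>, \<beta>) \<in> intervals ar A \<and> (\<gamma>, \<delta>) \<in> intervals ar A \<and>
     \<beta> \<inter> \<gamma> = \<alpha> \<and> con_join ar A \<beta> \<gamma> = \<delta>}"

definition projective :: "('f \<Rightarrow> nat) \<Rightarrow> ('f, 'a) ualg \<Rightarrow>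
    ((('a \<times> 'a) set \<times> ('a \<times> 'a) set) \<times> (('a \<times> 'a) set \<times> ('a \<times> 'a) set)) set" where
  "projective ar A = (transposes_up ar A \<union> (transposes_up ar A)\<inverse>)\<^sup>*"

definition Cm_sim :: "('f \<Rightarrow> nat) \<Rightarrow> ('f, 'a) ualg \<Rightarrow> (('a \<times> 'a) set \<times> ('a \<times> 'a) set) set" where
  "Cm_sim ar A = {(\<phi>, \<psi>). \<phi> \<in> Cm ar A \<and> \<psi> \<in> Cm ar A \<and>
     ((\<phi>, con_cover ar A \<phi>), (\<psi>, con_cover ar A \<psi>)) \<in> projective ar A}"


section \<open>The Boolean groups and hereditary sets\<close>

text \<open>
  An equivalence class \<open>U\<close> of \<open>Cm_sim ar A\<close> is given by a representative \<open>\<eta>\<close>, through which the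
  common cover \<open>\<eta>\<^sup>+\<close> of the members of \<open>U\<close> is also given.
\<close>

definition sim_class :: "('f \<Rightarrow> nat) \<Rightarrow> ('f, 'a) ualg \<Rightarrow> ('a \<times> 'a) set \<Rightarrow> ('a \<times> 'a) set set" where
  "sim_class ar A \<eta> = Cm_sim ar A `` {\<eta>}"

definition bar :: "('f \<Rightarrow> nat) \<Rightarrow> ('f, 'a) ualg \<Rightarrow> ('a \<times> 'a) set \<Rightarrow>
    ('a \<times> 'a) set set \<Rightarrow> ('a \<times> 'a) set set" where
  "bar ar A \<eta> S = S \<union> {con_cover ar A \<eta>}"

definition bullet :: "('f \<Rightarrow> nat) \<Rightarrow> ('f, 'a) ualg \<Rightarrow> ('a \<times> 'a) set \<Rightarrow>
    ('a \<times> 'a) set \<Rightarrow> ('a \<times> 'a) set \<Rightarrow> ('a \<times> 'a) set" where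
  "bullet ar A \<eta> \<phi> \<psi> =
     (carrier A \<times> carrier A - sym_diff \<phi> \<psi>) \<inter> con_cover ar A \<eta>"

definition bar_group :: "('f \<Rightarrow> nat) \<Rightarrow> ('f, 'a) ualg \<Rightarrow> ('a \<times> 'a) set \<Rightarrow> ('a \<times> 'a) set monoid" where
  "bar_group ar A \<eta> =
     \<lparr>carrier = bar ar A \<eta> (sim_class ar A \<eta>),
      mult = bullet ar A \<eta>,
      one = con_cover ar A \<eta>\<rparr>"

text \<open>For Boolean groups, i.e. vector spaces over the two-element field.\<close>

definition hyperplane :: "'g set \<Rightarrow> 'g monoid \<Rightarrow> bool" where
  "hyperplane H G \<longleftrightarrow> subgroup H G \<and> H \<noteq> carrier G \<and>
     (\<forall>K. subgroup K G \<and> H \<subseteq> K \<longrightarrow> K = H \<or> K = carrier G)"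

definition Up_Cm :: "('f \<Rightarrow> nat) \<Rightarrow> ('f, 'a) ualg \<Rightarrow> ('a \<times> 'a) set set set" where
  "Up_Cm ar A = {S. S \<subseteq> Cm ar A \<and> (\<forall>\<phi>\<in>S. \<forall>\<psi>\<in>Cm ar A. \<phi> \<subseteq> \<psi> \<longrightarrow> \<psi> \<in> S)}"

definition down :: "('f \<Rightarrow> nat) \<Rightarrow> ('f, 'a) ualg \<Rightarrow> ('a \<times> 'a) set set \<Rightarrow> ('a \<times> 'a) set set" where
  "down ar A X = {\<mu> \<in> Cm ar A. \<exists>\<phi>\<in>X. \<mu> \<subseteq> \<phi>}"

definition heyting_equiv :: "('f \<Rightarrow> nat) \<Rightarrow> ('f, 'a) ualg \<Rightarrow>
    ('a \<times> 'a) set set \<Rightarrow> ('a \<times> 'a) set set \<Rightarrow> ('a \<times> 'a) set set" where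
  "heyting_equiv ar A S T = Cm ar A - down ar A (sym_diff S T)"

definition above_class :: "('f \<Rightarrow> nat) \<Rightarrow> ('f, 'a) ualg \<Rightarrow> ('a \<times> 'a) set \<Rightarrow> ('a \<times> 'a) set set" where
  "above_class ar A \<eta> = {\<theta> \<in> Cm ar A. con_cover ar A \<eta> \<subseteq> \<theta>}"

definition hereditary :: "('f \<Rightarrow> nat) \<Rightarrow> ('f, 'a) ualg \<Rightarrow> ('a \<times> 'a) set set \<Rightarrow> bool" where
  "hereditary ar A Z \<longleftrightarrow> Z \<in> Up_Cm ar A \<and>
     (\<forall>\<eta>\<in>Cm ar A. above_class ar A \<eta> \<subseteq> Z \<longrightarrow>
        bar ar A \<eta> (Z \<inter> sim_class ar A \<eta>) = bar ar A \<eta> (sim_class ar A \<eta>) \<or>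
        hyperplane (bar ar A \<eta> (Z \<inter> sim_class ar A \<eta>)) (bar_group ar A \<eta>))"

definition hereditary_sets :: "('f \<Rightarrow> nat) \<Rightarrow> ('f, 'a) ualg \<Rightarrow> ('a \<times> 'a) set set set" where
  "hereditary_sets ar A = {Z. hereditary ar A Z}"

end

theory Submission
  imports Defs
begin

text \<open>
  Write \<open>\<eta>\<^sup>+\<close> for the cover of a completely meet irreducible congruence \<open>\<eta>\<close>, and \<open>U\<close> for a
  similarity class. If \<open>U\<^sup>+\<close> lies in \<open>S \<leftrightarrow> T\<close>, then \<open>S\<close> and \<open>T\<close> agree strictly above \<open>U\<close>, so
  \<open>(S \<leftrightarrow> T) \<inter> U\<close> consists of the \<open>\<mu> \<in> U\<close> that lie in both or in neither of \<open>S\<close>, \<open>T\<close>. When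
  \<open>U\<^sup>+\<close> is not contained in \<open>S\<close>, neither set meets \<open>U\<close> and \<open>S \<leftrightarrow> T\<close> contains \<open>U\<close>. Otherwise the
  traces of \<open>S\<close> and \<open>T\<close> are kernels of homomorphisms into \<open>\<int>\<^sub>2\<close>, and the trace of \<open>S \<leftrightarrow> T\<close> is the
  kernel of their sum (\<open>boolean_character_iff\<close>). This argument rests on two structural facts: all
  members of \<open>U\<close> have the same cover, and \<open>U\<close> with that cover adjoined is a group under \<open>\<bullet>\<close>.

  Both facts are proved for a relation that is easier to handle than projectivity. Call \<open>\<gamma>\<close> and
  \<open>\<delta>\<close> linked if some congruence \<open>\<beta>\<close> below both covers, but below neither \<open>\<gamma>\<close> nor \<open>\<delta>\<close>, satisfies
  \<open>\<beta> \<inter> \<gamma> = \<beta> \<inter> \<delta>\<close>; that is, both prime intervals transpose down to \<open>I[\<beta> \<inter> \<gamma>, \<beta>]\<close>.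
  Orderability of the quotient \<open>A/\<gamma>\<close> forces \<open>\<gamma>\<close> to differ from \<open>\<gamma>\<^sup>+\<close> only inside the class of the
  constant \<open>1\<close>, which \<open>\<gamma>\<close> splits into two blocks (\<open>two_blocks\<close>). So \<open>\<gamma>\<close> is a
  \<open>\<int>\<^sub>2\<close>-valued function on \<open>1/\<gamma>\<^sup>+\<close>, and \<open>\<bullet>\<close> is addition of such functions.

  The core is \<open>linked_cover_le\<close>: linked congruences have the same cover. In the language of
  commutators, for \<open>\<gamma> \<noteq> \<delta>\<close> both \<open>\<gamma>\<close> and \<open>\<delta>\<close> centralize \<open>\<beta>\<close> modulo \<open>\<beta> \<inter> \<gamma>\<close>, and in a Fregean
  subdirectly irreducible algebra of a modular variety nothing larger than the monolith centralizes
  an abelian monolith. Here no commutator theory is developed: the contradiction comes from one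
  application of the modular law to congruences of a suitable subalgebra of \<open>A\<^sup>4\<close>. Given equal covers, the
  third element of the line through \<open>\<gamma>\<close> and \<open>\<delta>\<close> is again completely meet irreducible and equals
  \<open>\<gamma> \<bullet> \<delta>\<close> (\<open>linked_bullet\<close>), which makes linkedness transitive as in a projective geometry
  (\<open>linked_trans\<close>). A chain of transposed intervals is then contracted to a single link
  (\<open>projective_linked\<close>), so that similarity and linkedness coincide (\<open>Cm_sim_iff_linked\<close>).
\<close>

section \<open>Homomorphisms, images and pairs\<close>

definition alg_hom :: "('f \<Rightarrow> nat) \<Rightarrow> ('f, 'a) ualg \<Rightarrow> ('f, 'b) ualg \<Rightarrow> ('a \<Rightarrow> 'b) \<Rightarrow> bool" where
  "alg_hom ar A B h \<longleftrightarrow> h ` carrier A \<subseteq> carrier B \<and>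
     (\<forall>f xs. length xs = ar f \<and> set xs \<subseteq> carrier A \<longrightarrow>
        h (interp A f xs) = interp B f (map h xs))"

lemma hom_onto_alg_hom: "hom_onto ar A B h \<Longrightarrow> alg_hom ar A B h"
  by (auto simp: hom_onto_def alg_hom_def)

lemma interp_closed:
  "is_algebra ar A \<Longrightarrow> length xs = ar f \<Longrightarrow> set xs \<subseteq> carrier A \<Longrightarrow> interp A f xs \<in> carrier A"
  by (auto simp: is_algebra_def)

lemma trm_val_closed:
  assumes "is_algebra ar A" "range \<rho> \<subseteq> carrier A" "wf_trm ar s"
  shows "trm_val A \<rho> s \<in> carrier A"
  using assms(3)
proof (induction s)
  case (Var x)
  then show ?case using assms(2) by auto
next
  case (Op f ts)
  then show ?case
    using interp_closed[OF assms(1), of "map (trm_val A \<rho>) ts" f] by auto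
qed

lemma trm_val_hom:
  assumes "is_algebra ar A" "alg_hom ar A B h" "range \<rho> \<subseteq> carrier A" "wf_trm ar s"
  shows "trm_val B (h \<circ> \<rho>) s = h (trm_val A \<rho> s)"
  using assms(4)
proof (induction s)
  case (Var x)
  then show ?case by simp
next
  case (Op f ts)
  have closed: "set (map (trm_val A \<rho>) ts) \<subseteq> carrier A"
    using Op.prems trm_val_closed[OF assms(1,3)] by auto
  have args: "map (trm_val B (h \<circ> \<rho>)) ts = map h (map (trm_val A \<rho>) ts)"
    unfolding map_map by (rule map_cong[OF refl]) (metis Op comp_apply wf_trm.simps(2))
  have len: "length (map (trm_val A \<rho>) ts) = ar f" using Op.prems by simp
  have "interp B f (map h (map (trm_val A \<rho>) ts)) = h (interp A f (map (trm_val A \<rho>) ts))"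
    using assms(2) closed len unfolding alg_hom_def by metis
  then show ?case unfolding trm_val.simps args .
qed

lemma lift_valuation:
  assumes "range \<rho> \<subseteq> h ` X"
  obtains \<sigma> where "range \<sigma> \<subseteq> X" "\<rho> = h \<circ> \<sigma>"
proof
  show "range (\<lambda>v. inv_into X h (\<rho> v)) \<subseteq> X"
    using assms by (auto intro!: inv_into_into)
  show "\<rho> = h \<circ> (\<lambda>v. inv_into X h (\<rho> v))"
    using assms by (auto simp: fun_eq_iff f_inv_into_f range_subsetD)
qed

lemma holds_in_image:
  fixes s t :: "('f, 'v) trm"
  assumes "is_algebra ar A" "hom_onto ar A B h" "wf_trm ar s" "wf_trm ar t" "holds_in A s t"
  shows "holds_in B s t"
  unfolding holds_in_def
proof (intro allI impI)
  fix \<rho> :: "'v \<Rightarrow> _" assume "range \<rho> \<subseteq> carrier B"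
  then have "range \<rho> \<subseteq> h ` carrier A" using assms(2) by (simp add: hom_onto_def)
  then obtain \<sigma> where "range \<sigma> \<subseteq> carrier A" "\<rho> = h \<circ> \<sigma>" by (rule lift_valuation)
  then show "trm_val B \<rho> s = trm_val B \<rho> t"
    using assms trm_val_hom[OF assms(1) hom_onto_alg_hom[OF assms(2)]]
    by (metis holds_in_def)
qed

lemma const_val_eq:
  assumes "is_algebra ar A" "constant_trm ar A t" "range \<rho> \<subseteq> carrier A"
  shows "trm_val A \<rho> t = const_val A t"
  unfolding const_val_def
proof (rule the_equality[symmetric])
  show "\<forall>\<sigma>. range \<sigma> \<subseteq> carrier A \<longrightarrow> trm_val A \<sigma> t = trm_val A \<rho> t"
    using assms(2,3) unfolding constant_trm_def by metis
  show "c = trm_val A \<rho> t" if "\<forall>\<sigma>. range \<sigma> \<subseteq> carrier A \<longrightarrow> trm_val A \<sigma> t = c" for c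
    using that assms(3) by metis
qed

lemma const_val_in:
  assumes "is_algebra ar A" "constant_trm ar A t"
  shows "const_val A t \<in> carrier A"
proof -
  obtain a where a: "a \<in> carrier A" using assms(1) by (auto simp: is_algebra_def)
  then have r: "range (\<lambda>_::nat. a) \<subseteq> carrier A" by auto
  then show ?thesis
    using const_val_eq[OF assms r] trm_val_closed[OF assms(1) r, of t] assms(2)
    by (simp add: constant_trm_def)
qed

lemma const_val_image:
  assumes "is_algebra ar A" "constant_trm ar A t" "is_algebra ar B" "hom_onto ar A B h"
  shows "const_val B t = h (const_val A t)"
proof -
  have wf: "wf_trm ar t" using assms(2) by (simp add: constant_trm_def)
  have val: "trm_val B \<rho> t = h (const_val A t)" if "range \<rho> \<subseteq> carrier B" for \<rho>
  proof -
    have "range \<rho> \<subseteq> h ` carrier A" using that assms(4) by (simp add: hom_onto_def)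
    then obtain \<sigma> where "range \<sigma> \<subseteq> carrier A" "\<rho> = h \<circ> \<sigma>" by (rule lift_valuation)
    then show ?thesis
      using trm_val_hom[OF assms(1) hom_onto_alg_hom[OF assms(4)] _ wf] const_val_eq[OF assms(1,2)]
      by metis
  qed
  then have c: "constant_trm ar B t" using wf by (simp add: constant_trm_def)
  obtain b where "b \<in> carrier B" using assms(3) by (auto simp: is_algebra_def)
  then have r: "range (\<lambda>_::nat. b) \<subseteq> carrier B" by auto
  show ?thesis using val[OF r] const_val_eq[OF assms(3) c r] by simp
qed


section \<open>Congruences\<close>

lemma ConI:
  assumes "equiv (carrier A) \<theta>"
    and "\<And>f xs ys. \<lbrakk>length xs = ar f; length ys = ar f; set xs \<subseteq> carrier A; set ys \<subseteq> carrier A;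
           \<And>i. i < ar f \<Longrightarrow> (xs ! i, ys ! i) \<in> \<theta>\<rbrakk> \<Longrightarrow> (interp A f xs, interp A f ys) \<in> \<theta>"
  shows "\<theta> \<in> Con ar A"
proof -
  have sub: "\<theta> \<subseteq> carrier A \<times> carrier A" using assms(1) by (auto simp: equiv_def refl_on_def)
  have "(interp A f xs, interp A f ys) \<in> \<theta>"
    if h: "length xs = ar f" "length ys = ar f" "\<forall>i<ar f. (xs ! i, ys ! i) \<in> \<theta>" for f xs ys
  proof (rule assms(2))
    show "set xs \<subseteq> carrier A" "set ys \<subseteq> carrier A"
      using h sub unfolding subset_iff in_set_conv_nth by (metis mem_Sigma_iff subsetD)+
  qed (use h in auto)
  then show ?thesis using assms(1) by (auto simp: Con_def)
qed

lemma Con_equiv: "\<theta> \<in> Con ar A \<Longrightarrow> equiv (carrier A) \<theta>"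
  by (simp add: Con_def)

lemma Con_sub: "\<theta> \<in> Con ar A \<Longrightarrow> \<theta> \<subseteq> carrier A \<times> carrier A"
  by (auto dest!: Con_equiv simp: equiv_def refl_on_def)

lemma Con_in1: "\<theta> \<in> Con ar A \<Longrightarrow> (x, y) \<in> \<theta> \<Longrightarrow> x \<in> carrier A"
  using Con_sub by auto

lemma Con_in2: "\<theta> \<in> Con ar A \<Longrightarrow> (x, y) \<in> \<theta> \<Longrightarrow> y \<in> carrier A"
  using Con_sub by auto

lemma Con_refl: "\<theta> \<in> Con ar A \<Longrightarrow> x \<in> carrier A \<Longrightarrow> (x, x) \<in> \<theta>"
  by (auto dest!: Con_equiv simp: equiv_def refl_on_def)

lemma Con_sym: "\<theta> \<in> Con ar A \<Longrightarrow> (x, y) \<in> \<theta> \<Longrightarrow> (y, x) \<in> \<theta>"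
  by (auto dest!: Con_equiv simp: equiv_def sym_def)

lemma Con_trans: "\<theta> \<in> Con ar A \<Longrightarrow> (x, y) \<in> \<theta> \<Longrightarrow> (y, z) \<in> \<theta> \<Longrightarrow> (x, z) \<in> \<theta>"
  by (auto dest!: Con_equiv simp: equiv_def intro: transD)

lemma Con_interp:
  "\<theta> \<in> Con ar A \<Longrightarrow> length xs = ar f \<Longrightarrow> length ys = ar f \<Longrightarrow>
   (\<And>i. i < ar f \<Longrightarrow> (xs ! i, ys ! i) \<in> \<theta>) \<Longrightarrow> (interp A f xs, interp A f ys) \<in> \<theta>"
  by (simp add: Con_def)

lemma equivI_on:
  assumes "\<theta> \<subseteq> X \<times> X" "\<And>x. x \<in> X \<Longrightarrow> (x, x) \<in> \<theta>" "\<And>x y. (x, y) \<in> \<theta> \<Longrightarrow> (y, x) \<in> \<theta>"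
    "\<And>x y z. (x, y) \<in> \<theta> \<Longrightarrow> (y, z) \<in> \<theta> \<Longrightarrow> (x, z) \<in> \<theta>"
  shows "equiv X \<theta>"
  using assms unfolding equiv_def refl_on_def sym_def trans_def by blast

lemma Con_Inter:
  assumes "is_algebra ar A" "S \<subseteq> Con ar A"
  shows "(carrier A \<times> carrier A) \<inter> \<Inter>S \<in> Con ar A"
proof (rule ConI)
  have SC: "\<And>\<theta>. \<theta> \<in> S \<Longrightarrow> \<theta> \<in> Con ar A" using assms(2) by auto
  show "equiv (carrier A) (carrier A \<times> carrier A \<inter> \<Inter> S)"
  proof (rule equivI_on)
    show "\<And>x. x \<in> carrier A \<Longrightarrow> (x, x) \<in> carrier A \<times> carrier A \<inter> \<Inter> S"
      by (auto intro: Con_refl[OF SC])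
    show "\<And>x y. (x, y) \<in> carrier A \<times> carrier A \<inter> \<Inter> S \<Longrightarrow>
           (y, x) \<in> carrier A \<times> carrier A \<inter> \<Inter> S"
      by (auto intro: Con_sym[OF SC])
    show "\<And>x y z. (x, y) \<in> carrier A \<times> carrier A \<inter> \<Inter> S \<Longrightarrow>
       (y, z) \<in> carrier A \<times> carrier A \<inter> \<Inter> S \<Longrightarrow> (x, z) \<in> carrier A \<times> carrier A \<inter> \<Inter> S"
      by (auto intro: Con_trans[OF SC])
  qed auto
  fix f xs ys
  assume h: "length xs = ar f" "length ys = ar f" "set xs \<subseteq> carrier A" "set ys \<subseteq> carrier A"
    "\<And>i. i < ar f \<Longrightarrow> (xs ! i, ys ! i) \<in> carrier A \<times> carrier A \<inter> \<Inter> S"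
  have "(interp A f xs, interp A f ys) \<in> \<theta>" if "\<theta> \<in> S" for \<theta>
    by (rule Con_interp) (use that assms h in auto)
  then show "(interp A f xs, interp A f ys) \<in> carrier A \<times> carrier A \<inter> \<Inter> S"
    using interp_closed[OF assms(1)] h by auto
qed

lemma Con_full: "is_algebra ar A \<Longrightarrow> carrier A \<times> carrier A \<in> Con ar A"
  using Con_Inter[of ar A "{}"] by simp

lemma Con_Int:
  assumes "is_algebra ar A" "\<alpha> \<in> Con ar A" "\<beta> \<in> Con ar A"
  shows "\<alpha> \<inter> \<beta> \<in> Con ar A"
proof -
  have "carrier A \<times> carrier A \<inter> \<Inter>{\<alpha>, \<beta>} = \<alpha> \<inter> \<beta>" using Con_sub assms by auto
  then show ?thesis using Con_Inter[OF assms(1), of "{\<alpha>, \<beta>}"] assms by simp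
qed

lemma con_join_Con:
  assumes "is_algebra ar A" "\<alpha> \<in> Con ar A" "\<beta> \<in> Con ar A"
  shows "con_join ar A \<alpha> \<beta> \<in> Con ar A"
proof -
  let ?S = "{\<gamma> \<in> Con ar A. \<alpha> \<subseteq> \<gamma> \<and> \<beta> \<subseteq> \<gamma>}"
  have "carrier A \<times> carrier A \<in> ?S" using Con_full[OF assms(1)] Con_sub assms by blast
  then have "carrier A \<times> carrier A \<inter> \<Inter>?S = \<Inter>?S" by blast
  then show ?thesis unfolding con_join_def using Con_Inter[OF assms(1), of ?S] by auto
qed

lemma con_join_ub1: "\<alpha> \<subseteq> con_join ar A \<alpha> \<beta>" and con_join_ub2: "\<beta> \<subseteq> con_join ar A \<alpha> \<beta>"
  by (auto simp: con_join_def)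

lemma con_join_least:
  "\<gamma> \<in> Con ar A \<Longrightarrow> \<alpha> \<subseteq> \<gamma> \<Longrightarrow> \<beta> \<subseteq> \<gamma> \<Longrightarrow> con_join ar A \<alpha> \<beta> \<subseteq> \<gamma>"
  by (auto simp: con_join_def)

lemma con_join_comm: "con_join ar A \<alpha> \<beta> = con_join ar A \<beta> \<alpha>"
  unfolding con_join_def by (rule arg_cong[where f=Inter]) auto

text \<open>
  Two argument lists that are related entry by entry are joined by a path that replaces one entry at
  a time, and transitivity composes its steps.
\<close>

lemma Con_coordinatewise:
  assumes alg: "is_algebra ar A" and eq: "equiv (carrier A) \<theta>"
    and step: "\<And>f xs i y. \<lbrakk>length xs = ar f; set xs \<subseteq> carrier A; i < ar f; (xs ! i, y) \<in> \<theta>\<rbrakk>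
       \<Longrightarrow> (interp A f xs, interp A f (xs[i := y])) \<in> \<theta>"
  shows "\<theta> \<in> Con ar A"
proof (rule ConI[OF eq])
  fix f xs ys
  assume h: "length xs = ar f" "length ys = ar f" "set xs \<subseteq> carrier A" "set ys \<subseteq> carrier A"
    "\<And>i. i < ar f \<Longrightarrow> (xs ! i, ys ! i) \<in> \<theta>"
  define zs where "zs k = take k ys @ drop k xs" for k
  have "k \<le> ar f \<Longrightarrow> (interp A f xs, interp A f (zs k)) \<in> \<theta>" for k
  proof (induction k)
    case 0
    then show ?case using eq interp_closed[OF alg h(1,3)] 
      by (auto simp: zs_def equiv_def refl_on_def)
  next
    case (Suc k)
    have len: "length (zs k) = ar f" using h Suc.prems by (simp add: zs_def)
    have sub: "set (zs k) \<subseteq> carrier A"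
      using h by (auto simp: zs_def dest: in_set_takeD in_set_dropD)
    have nth: "zs k ! k = xs ! k" using h Suc.prems by (simp add: zs_def nth_append)
    have upd: "zs (Suc k) = (zs k)[k := ys ! k]"
      using h Suc.prems
      by (simp add: zs_def list_update_append take_Suc_conv_app_nth flip: Cons_nth_drop_Suc)
    have "(interp A f (zs k), interp A f (zs (Suc k))) \<in> \<theta>"
      unfolding upd by (rule step) (use len sub nth h Suc.prems in auto)
    then show ?case using Suc eq by (auto simp: equiv_def intro: transD)
  qed
  from this[of "ar f"] show "(interp A f xs, interp A f ys) \<in> \<theta>"
    using h by (simp add: zs_def)
qed

text \<open>
  Paths for different arguments of an operation may have different lengths. With the other
  arguments fixed, however, an operation carries a path in one argument to a path between values,
  and by the coordinatewise criterion this makes the transitive closure a congruence.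
\<close>

lemma con_join_trancl:
  assumes alg: "is_algebra ar A" and "\<alpha> \<in> Con ar A" "\<beta> \<in> Con ar A"
  shows "con_join ar A \<alpha> \<beta> \<subseteq> (\<alpha> \<union> \<beta>)\<^sup>+"
proof (rule con_join_least)
  let ?T = "(\<alpha> \<union> \<beta>)\<^sup>+"
  have sub: "\<alpha> \<union> \<beta> \<subseteq> carrier A \<times> carrier A" using assms Con_sub by auto
  then have Tsub: "?T \<subseteq> carrier A \<times> carrier A" by (rule trancl_subset_Sigma)
  show "?T \<in> Con ar A"
  proof (rule Con_coordinatewise[OF alg])
    show "equiv (carrier A) ?T"
    proof (rule equivI_on[OF Tsub])
      show "\<And>x. x \<in> carrier A \<Longrightarrow> (x, x) \<in> ?T" using Con_refl[OF assms(2)] by auto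
      have "sym (\<alpha> \<union> \<beta>)" using Con_sym[OF assms(2)] Con_sym[OF assms(3)] by (auto intro!: symI)
      then show "\<And>x y. (x, y) \<in> ?T \<Longrightarrow> (y, x) \<in> ?T" by (meson sym_trancl symD)
    qed auto
    fix f xs i y
    assume h: "length xs = ar f" "set xs \<subseteq> carrier A" "i < ar f" "(xs ! i, y) \<in> ?T"
    have one: "(interp A f (xs[i := u]), interp A f (xs[i := v])) \<in> \<alpha> \<union> \<beta>"
      if uv: "(u, v) \<in> \<alpha> \<union> \<beta>" for u v
    proof -
      have "(interp A f (xs[i := u]), interp A f (xs[i := v])) \<in> \<theta>"
        if "\<theta> \<in> Con ar A" "(u, v) \<in> \<theta>" for \<theta>
        by (rule Con_interp[OF that(1)]) (use h that Con_refl[OF that(1)] nth_mem[of _ xs] in \<open>auto simp: nth_list_update subset_iff\<close>)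
      then show ?thesis using uv assms by auto
    qed
    from h(4) show "(interp A f xs, interp A f (xs[i := y])) \<in> ?T"
    proof (induction rule: trancl_induct)
      case (base y)
      show ?case using one[OF base] unfolding list_update_id by (rule r_into_trancl)
    next
      case (step y z)
      then show ?case using one[OF step(2)] by (meson trancl.trancl_into_trancl)
    qed
  qed
qed auto

definition pull :: "('f, 'a) ualg \<Rightarrow> ('a \<Rightarrow> 'b) \<Rightarrow> ('b \<times> 'b) set \<Rightarrow> ('a \<times> 'a) set" where
  "pull A h \<sigma> = {(x, y). x \<in> carrier A \<and> y \<in> carrier A \<and> (h x, h y) \<in> \<sigma>}"

lemma pull_Con:
  assumes "is_algebra ar A" "alg_hom ar A B h" "\<sigma> \<in> Con ar B"
  shows "pull A h \<sigma> \<in> Con ar A"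
proof (rule ConI)
  have hB: "h x \<in> carrier B" if "x \<in> carrier A" for x using that assms(2) by (auto simp: alg_hom_def)
  show "equiv (carrier A) (pull A h \<sigma>)"
    by (rule equivI_on)
      (auto simp: pull_def intro: Con_refl[OF assms(3)] Con_sym[OF assms(3)] Con_trans[OF assms(3)] hB)
  fix f xs ys
  assume h: "length xs = ar f" "length ys = ar f" "set xs \<subseteq> carrier A" "set ys \<subseteq> carrier A"
    "\<And>i. i < ar f \<Longrightarrow> (xs ! i, ys ! i) \<in> pull A h \<sigma>"
  have "(interp B f (map h xs), interp B f (map h ys)) \<in> \<sigma>"
    by (rule Con_interp[OF assms(3)]) (use h in \<open>auto simp: pull_def\<close>)
  then show "(interp A f xs, interp A f ys) \<in> pull A h \<sigma>"
    using h assms(2) interp_closed[OF assms(1)] by (auto simp: pull_def alg_hom_def)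
qed

lemma Con_Id: "is_algebra ar A \<Longrightarrow> Id_on (carrier A) \<in> Con ar A"
proof (rule ConI)
  fix f xs ys
  assume alg: "is_algebra ar A"
    and h: "length xs = ar f" "length ys = ar f" "set xs \<subseteq> carrier A" "set ys \<subseteq> carrier A"
    "\<And>i. i < ar f \<Longrightarrow> (xs ! i, ys ! i) \<in> Id_on (carrier A)"
  have "xs = ys" by (rule nth_equalityI) (use h in \<open>auto simp: Id_on_iff\<close>)
  then show "(interp A f xs, interp A f ys) \<in> Id_on (carrier A)"
    using interp_closed[OF alg h(1,3)] by auto
qed (auto intro!: equivI_on)

text \<open>
  When the kernel of \<open>e\<close> is a congruence, this is the quotient by it, realised on the image of \<open>e\<close>.
  The same construction gives quotients (\<open>e\<close> sends an element to its class) and copies in another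
  type (\<open>e\<close> injective).
\<close>

definition image_alg :: "('f, 'a) ualg \<Rightarrow> ('a \<Rightarrow> 'b) \<Rightarrow> ('f, 'b) ualg" where
  "image_alg A e = \<lparr>carrier = e ` carrier A,
     interp = (\<lambda>f ys. e (interp A f (map (inv_into (carrier A) e) ys)))\<rparr>"

lemma image_alg_hom:
  assumes alg: "is_algebra ar A" and ker: "pull A e Id \<in> Con ar A"
  shows "is_algebra ar (image_alg A e)" "hom_onto ar A (image_alg A e) e"
proof -
  let ?i = "inv_into (carrier A) e"
  have inv: "?i y \<in> carrier A" "e (?i y) = y" if "y \<in> e ` carrier A" for y
    using that by (auto intro: inv_into_into f_inv_into_f)
  show "is_algebra ar (image_alg A e)"
  proof -
    have "interp A f (map ?i ys) \<in> carrier A" if "length ys = ar f" "set ys \<subseteq> e ` carrier A" for f ys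
      by (rule interp_closed[OF alg]) (use that inv in auto)
    then show ?thesis using alg by (auto simp: is_algebra_def image_alg_def)
  qed
  have "(interp A f xs, interp A f (map ?i (map e xs))) \<in> pull A e Id"
    if h: "length xs = ar f" "set xs \<subseteq> carrier A" for f xs
    by (rule Con_interp[OF ker])
      (use h inv[OF imageI] in \<open>simp_all add: pull_def subset_iff in_set_conv_nth\<close>, metis)
  then show "hom_onto ar A (image_alg A e) e"
    by (auto simp: hom_onto_def image_alg_def pull_def)
qed

lemma pull_inj: "inj_on e (carrier A) \<Longrightarrow> pull A e Id = Id_on (carrier A)"
  by (auto simp: pull_def inj_on_def)

definition push :: "('a \<Rightarrow> 'b) \<Rightarrow> ('a \<times> 'a) set \<Rightarrow> ('b \<times> 'b) set" where
  "push e \<theta> = map_prod e e ` \<theta>"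

lemma push_iff:
  assumes "inj_on e (carrier A)" "\<theta> \<in> Con ar A" "x \<in> carrier A" "y \<in> carrier A"
  shows "(e x, e y) \<in> push e \<theta> \<longleftrightarrow> (x, y) \<in> \<theta>"
  using assms Con_sub[OF assms(2)] by (auto simp: push_def dest: inj_onD)

text \<open>
  A copy of \<open>A\<close> maps back to \<open>A\<close> by the inverse bijection, and pulling \<open>\<theta>\<close> back along it gives the
  direct image.
\<close>

lemma push_Con:
  assumes alg: "is_algebra ar A" and inj: "inj_on e (carrier A)" and \<theta>: "\<theta> \<in> Con ar A"
  shows "push e \<theta> \<in> Con ar (image_alg A e)"
proof -
  let ?B = "image_alg A e" and ?i = "inv_into (carrier A) e"
  have hom: "is_algebra ar ?B" "hom_onto ar A ?B e"
    by (simp_all add: image_alg_hom[OF alg] pull_inj[OF inj] Con_Id[OF alg])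
  have cB: "carrier ?B = e ` carrier A" by (simp add: image_alg_def)
  have ih: "?i (e x) = x" if "x \<in> carrier A" for x using that inj by simp
  have "alg_hom ar ?B A ?i"
    unfolding alg_hom_def
  proof (intro conjI allI impI)
    show "?i ` carrier ?B \<subseteq> carrier A" using cB ih by auto
    fix f xs assume h: "length xs = ar f \<and> set xs \<subseteq> carrier ?B"
    have "interp A f (map ?i xs) \<in> carrier A"
      by (rule interp_closed[OF alg]) (use h cB ih in auto)
    then show "?i (interp ?B f xs) = interp A f (map ?i xs)"
      by (simp add: image_alg_def ih)
  qed
  from pull_Con[OF hom(1) this \<theta>] have "pull ?B ?i \<theta> \<in> Con ar ?B" .
  moreover have "pull ?B ?i \<theta> = push e \<theta>"
    using Con_sub[OF \<theta>] by (force simp: pull_def push_def cB ih)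
  ultimately show ?thesis by simp
qed


section \<open>Modularity in powers\<close>

text \<open>
  Isomorphic algebras have isomorphic congruence lattices. Only joins need care, because they are
  intersections over the congruences of two different algebras; pulling back and pushing forward
  the congruences that bound them moves membership in a join across the isomorphism.
\<close>

lemma modular_Con_via_image:
  assumes alg: "is_algebra ar B" and inj: "inj_on e (carrier B)"
    and mod: "modular_Con ar (image_alg B e)"
  shows "modular_Con ar B"
  unfolding modular_Con_def
proof (intro ballI impI)
  fix \<alpha> \<beta> \<gamma> assume c: "\<alpha> \<in> Con ar B" "\<beta> \<in> Con ar B" "\<gamma> \<in> Con ar B" and ac: "\<alpha> \<subseteq> \<gamma>"
  let ?D = "image_alg B e"
  have hom: "alg_hom ar B ?D e"
    using image_alg_hom[OF alg] pull_inj[OF inj] Con_Id[OF alg] hom_onto_alg_hom by metis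
  note P = push_Con[OF alg inj]
  show "con_join ar B \<alpha> (\<beta> \<inter> \<gamma>) = con_join ar B \<alpha> \<beta> \<inter> \<gamma>"
  proof
    show "con_join ar B \<alpha> (\<beta> \<inter> \<gamma>) \<subseteq> con_join ar B \<alpha> \<beta> \<inter> \<gamma>"
    proof (rule con_join_least[OF Con_Int[OF alg con_join_Con[OF alg c(1,2)] c(3)]])
      show "\<alpha> \<subseteq> con_join ar B \<alpha> \<beta> \<inter> \<gamma>" using ac by (simp add: con_join_ub1)
      show "\<beta> \<inter> \<gamma> \<subseteq> con_join ar B \<alpha> \<beta> \<inter> \<gamma>" using con_join_ub2[of \<beta> ar B \<alpha>] by auto
    qed
    show "con_join ar B \<alpha> \<beta> \<inter> \<gamma> \<subseteq> con_join ar B \<alpha> (\<beta> \<inter> \<gamma>)"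
    proof clarify
      fix x y assume j: "(x, y) \<in> con_join ar B \<alpha> \<beta>" and g: "(x, y) \<in> \<gamma>"
      have xy: "x \<in> carrier B" "y \<in> carrier B" using g Con_sub[OF c(3)] by auto
      have "(e x, e y) \<in> con_join ar ?D (push e \<alpha>) (push e \<beta>)"
        unfolding con_join_def
      proof clarify
        fix \<sigma> assume s: "\<sigma> \<in> Con ar ?D" "push e \<alpha> \<subseteq> \<sigma>" "push e \<beta> \<subseteq> \<sigma>"
        have "\<alpha> \<subseteq> pull B e \<sigma>" "\<beta> \<subseteq> pull B e \<sigma>"
          using s Con_sub[OF c(1)] Con_sub[OF c(2)] by (force simp: pull_def push_def)+
        then have "con_join ar B \<alpha> \<beta> \<subseteq> pull B e \<sigma>"
          using con_join_least[OF pull_Con[OF alg hom s(1)]] by blast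
        then show "(e x, e y) \<in> \<sigma>" using j by (auto simp: pull_def)
      qed
      moreover have "(e x, e y) \<in> push e \<gamma>" using g by (auto simp: push_def)
      moreover have "push e \<alpha> \<subseteq> push e \<gamma>" using ac by (auto simp: push_def)
      ultimately have m: "(e x, e y) \<in> con_join ar ?D (push e \<alpha>) (push e \<beta> \<inter> push e \<gamma>)"
        using mod P c unfolding modular_Con_def by blast
      show "(x, y) \<in> con_join ar B \<alpha> (\<beta> \<inter> \<gamma>)"
        unfolding con_join_def
      proof clarify
        fix \<sigma> assume s: "\<sigma> \<in> Con ar B" "\<alpha> \<subseteq> \<sigma>" "\<beta> \<inter> \<gamma> \<subseteq> \<sigma>"
        have "push e \<beta> \<inter> push e \<gamma> \<subseteq> push e \<sigma>"
        proof clarify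
          fix u v assume uv: "(u, v) \<in> push e \<beta>" "(u, v) \<in> push e \<gamma>"
          then obtain p q where pq: "u = e p" "v = e q" "(p, q) \<in> \<beta>" by (auto simp: push_def)
          then have "(p, q) \<in> \<gamma>" using uv(2) push_iff[OF inj c(3)] c(2) Con_in1 Con_in2 by metis
          then show "(u, v) \<in> push e \<sigma>" using pq s by (force simp: push_def)
        qed
        moreover have "push e \<alpha> \<subseteq> push e \<sigma>" using s by (auto simp: push_def)
        ultimately have "(e x, e y) \<in> push e \<sigma>"
          using m con_join_least[OF P[OF s(1)]] by blast
        then show "(x, y) \<in> \<sigma>" using push_iff[OF inj s(1) xy] by simp
      qed
    qed
  qed
qed

text \<open>
  Congruence modularity of the variety is stated for carriers in one particular type, so members of
  the variety over other types enter through an injection into that type.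
\<close>

lemma modular_Con_member:
  fixes A :: "('f, 'a) ualg" and e :: "'b \<Rightarrow> ('f, 'a + nat) trm set"
  assumes V: "cong_modular_variety_of ar A" and B: "in_variety_of ar A B"
    and inj: "inj_on e (carrier B)"
  shows "modular_Con ar B"
proof (rule modular_Con_via_image[OF _ inj])
  show alg: "is_algebra ar B" using B by (simp add: in_variety_of_def)
  note hom = image_alg_hom[OF alg, of e, unfolded pull_inj[OF inj], OF Con_Id[OF alg]]
  have "in_variety_of ar A (image_alg B e)"
    using B hom holds_in_image[OF alg hom(2)] by (auto simp: in_variety_of_def)
  then show "modular_Con ar (image_alg B e)" using V by (simp add: cong_modular_variety_of_def)
qed

text \<open>
  A congruence \<open>\<theta>\<close> is a subalgebra of \<open>A\<^sup>2\<close>. Iterating the construction gives algebras of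
  \<open>2 \<times> 2\<close> matrices over \<open>A\<close>.
\<close>

definition pair_alg :: "('f, 'a) ualg \<Rightarrow> ('a \<times> 'a) set \<Rightarrow> ('f, 'a \<times> 'a) ualg" where
  "pair_alg A \<theta> = \<lparr>carrier = \<theta>,
     interp = (\<lambda>f xs. (interp A f (map fst xs), interp A f (map snd xs)))\<rparr>"

lemma carrier_pair_alg [simp]: "carrier (pair_alg A \<theta>) = \<theta>"
  by (simp add: pair_alg_def)

lemma pair_alg_algebra:
  assumes "is_algebra ar A" "\<theta> \<in> Con ar A"
  shows "is_algebra ar (pair_alg A \<theta>)"
proof -
  have "\<theta> \<noteq> {}" using assms Con_refl[OF assms(2)] by (auto simp: is_algebra_def)
  moreover have "(interp A f (map fst xs), interp A f (map snd xs)) \<in> \<theta>"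
    if "length xs = ar f" "set xs \<subseteq> \<theta>" for f xs
    by (rule Con_interp[OF assms(2)]) (use that in auto)
  ultimately show ?thesis by (auto simp: is_algebra_def pair_alg_def)
qed

lemma pair_alg_proj:
  assumes "\<theta> \<in> Con ar A"
  shows "alg_hom ar (pair_alg A \<theta>) A fst" "alg_hom ar (pair_alg A \<theta>) A snd"
  using Con_sub[OF assms] by (auto simp: alg_hom_def pair_alg_def)

lemma pair_alg_diag:
  assumes "\<theta> \<in> Con ar A"
  shows "alg_hom ar A (pair_alg A \<theta>) (\<lambda>a. (a, a))"
  using Con_refl[OF assms] by (auto simp: alg_hom_def pair_alg_def comp_def)

lemma alg_hom_comp:
  assumes "alg_hom ar A B g" "alg_hom ar B C h"
  shows "alg_hom ar A C (h \<circ> g)"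
  unfolding alg_hom_def
proof (intro conjI allI impI)
  show "(h \<circ> g) ` carrier A \<subseteq> carrier C" using assms by (auto simp: alg_hom_def image_subset_iff)
  fix f xs assume x: "length xs = ar f \<and> set xs \<subseteq> carrier A"
  then have "set (map g xs) \<subseteq> carrier B" using assms(1) by (auto simp: alg_hom_def)
  then show "(h \<circ> g) (interp A f xs) = interp C f (map (h \<circ> g) xs)"
    using assms x unfolding alg_hom_def by (metis comp_apply length_map map_map)
qed

lemma in_variety_of_self: "is_algebra ar A \<Longrightarrow> in_variety_of ar A A"
  by (simp add: in_variety_of_def)

lemma in_variety_of_pair_alg:
  fixes A :: "('f, 'a) ualg"
  assumes B: "in_variety_of ar A B" and \<theta>: "\<theta> \<in> Con ar B"
  shows "in_variety_of ar A (pair_alg B \<theta>)"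
proof -
  have alg: "is_algebra ar B" using B by (simp add: in_variety_of_def)
  note Q = pair_alg_algebra[OF alg \<theta>] and pr = pair_alg_proj[OF \<theta>]
  have "holds_in (pair_alg B \<theta>) s t"
    if st: "wf_trm ar s" "wf_trm ar t" "holds_in A s t" for s t :: "('f, nat) trm"
    unfolding holds_in_def
  proof (intro allI impI)
    fix \<rho> :: "nat \<Rightarrow> _" assume r: "range \<rho> \<subseteq> carrier (pair_alg B \<theta>)"
    have b: "holds_in B s t" using B st by (simp add: in_variety_of_def)
    have "h (trm_val (pair_alg B \<theta>) \<rho> s) = h (trm_val (pair_alg B \<theta>) \<rho> t)"
      if hh: "alg_hom ar (pair_alg B \<theta>) B h" for h
    proof -
      have "range (h \<circ> \<rho>) \<subseteq> carrier B" using r hh unfolding alg_hom_def by fastforce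
      then show ?thesis using b trm_val_hom[OF Q hh r] st by (metis holds_in_def)
    qed
    from this[OF pr(1)] this[OF pr(2)]
    show "trm_val (pair_alg B \<theta>) \<rho> s = trm_val (pair_alg B \<theta>) \<rho> t" by (simp add: prod_eq_iff)
  qed
  then show ?thesis using Q by (auto simp: in_variety_of_def)
qed

section \<open>Modular congruence lattices\<close>

locale congruence_modular =
  fixes ar :: "'f \<Rightarrow> nat" and A :: "('f, 'a) ualg"
  assumes algebra: "is_algebra ar A" and modular: "modular_Con ar A"
begin

abbreviation join (infixl "\<curlyvee>" 65) where "\<alpha> \<curlyvee> \<beta> \<equiv> con_join ar A \<alpha> \<beta>"

abbreviation cover where "cover \<equiv> con_cover ar A"

lemmas Int_Con = Con_Int[OF algebra] and join_Con = con_join_Con[OF algebra]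
lemmas join_ub1 = con_join_ub1[where ar=ar and A=A] and join_ub2 = con_join_ub2[where ar=ar and A=A]
lemmas join_least = con_join_least[where ar=ar and A=A]
  and join_comm = con_join_comm[where ar=ar and A=A]

lemma modular_law:
  "\<alpha> \<in> Con ar A \<Longrightarrow> \<beta> \<in> Con ar A \<Longrightarrow> \<gamma> \<in> Con ar A \<Longrightarrow> \<alpha> \<subseteq> \<gamma> \<Longrightarrow>
   (\<alpha> \<curlyvee> \<beta>) \<inter> \<gamma> = \<alpha> \<curlyvee> (\<beta> \<inter> \<gamma>)"
  using modular by (simp add: modular_Con_def)

lemma join_absorb: "\<gamma> \<in> Con ar A \<Longrightarrow> \<beta> \<subseteq> \<gamma> \<Longrightarrow> \<gamma> \<curlyvee> \<beta> = \<gamma>"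
  by (rule subset_antisym[OF join_least join_ub1]) auto

definition prime_interval :: "('a \<times> 'a) set \<Rightarrow> ('a \<times> 'a) set \<Rightarrow> bool" where
  "prime_interval \<alpha> \<beta> \<longleftrightarrow> \<alpha> \<in> Con ar A \<and> \<beta> \<in> Con ar A \<and> \<alpha> \<subset> \<beta> \<and>
     (\<forall>\<xi>\<in>Con ar A. \<alpha> \<subseteq> \<xi> \<longrightarrow> \<xi> \<subseteq> \<beta> \<longrightarrow> \<xi> = \<alpha> \<or> \<xi> = \<beta>)"

lemma prime_intervalD:
  assumes "prime_interval \<alpha> \<beta>"
  shows "\<alpha> \<in> Con ar A" "\<beta> \<in> Con ar A" "\<alpha> \<subseteq> \<beta>" "\<not> \<beta> \<subseteq> \<alpha>"
  using assms by (auto simp: prime_interval_def)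

lemma prime_interval_cases:
  "prime_interval \<alpha> \<beta> \<Longrightarrow> \<xi> \<in> Con ar A \<Longrightarrow> \<alpha> \<subseteq> \<xi> \<Longrightarrow> \<xi> \<subseteq> \<beta> \<Longrightarrow> \<xi> = \<alpha> \<or> \<xi> = \<beta>"
  by (simp add: prime_interval_def)

text \<open>
  Dedekind's transposition principle: \<open>\<xi> \<mapsto> \<beta> \<inter> \<xi>\<close> is injective on \<open>I[\<gamma>, \<beta> \<curlyvee> \<gamma>]\<close>, since \<open>\<gamma> \<curlyvee> (\<beta> \<inter> \<xi>)\<close>
  recovers \<open>\<xi>\<close>.
\<close>

lemma prime_transpose_up:
  assumes p: "prime_interval (\<beta> \<inter> \<gamma>) \<beta>" and \<gamma>: "\<gamma> \<in> Con ar A"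
  shows "prime_interval \<gamma> (\<beta> \<curlyvee> \<gamma>)"
proof -
  have \<beta>: "\<beta> \<in> Con ar A" using p by (simp add: prime_interval_def)
  have "\<xi> = \<gamma> \<or> \<xi> = \<beta> \<curlyvee> \<gamma>" if \<xi>: "\<xi> \<in> Con ar A" "\<gamma> \<subseteq> \<xi>" "\<xi> \<subseteq> \<beta> \<curlyvee> \<gamma>" for \<xi>
  proof -
    have "\<xi> = (\<gamma> \<curlyvee> \<beta>) \<inter> \<xi>" using \<xi>(3) join_comm[of \<beta> \<gamma>] by auto
    also have "\<dots> = \<gamma> \<curlyvee> (\<beta> \<inter> \<xi>)" by (rule modular_law[OF \<gamma> \<beta> \<xi>(1,2)])
    finally have e: "\<xi> = \<gamma> \<curlyvee> (\<beta> \<inter> \<xi>)" .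
    have "\<beta> \<inter> \<xi> = \<beta> \<inter> \<gamma> \<or> \<beta> \<inter> \<xi> = \<beta>"
      by (rule prime_interval_cases[OF p Int_Con[OF \<beta> \<xi>(1)]]) (use \<xi>(2) in auto)
    then show ?thesis using e join_absorb[OF \<gamma>, of "\<beta> \<inter> \<gamma>"] join_comm[of \<gamma> \<beta>] by auto
  qed
  moreover have "\<gamma> \<noteq> \<beta> \<curlyvee> \<gamma>" using prime_intervalD(4)[OF p] join_ub1[of \<beta> \<gamma>] by auto
  ultimately show ?thesis
    using join_Con[OF \<beta> \<gamma>] \<gamma> join_ub2[of \<gamma> \<beta>] unfolding prime_interval_def by (simp add: psubset_eq)
qed

lemma prime_transpose_down:
  assumes p: "prime_interval \<gamma> (\<beta> \<curlyvee> \<gamma>)" and \<beta>: "\<beta> \<in> Con ar A"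
  shows "prime_interval (\<beta> \<inter> \<gamma>) \<beta>"
proof -
  have \<gamma>: "\<gamma> \<in> Con ar A" using p by (simp add: prime_interval_def)
  have "\<xi> = \<beta> \<inter> \<gamma> \<or> \<xi> = \<beta>" if \<xi>: "\<xi> \<in> Con ar A" "\<beta> \<inter> \<gamma> \<subseteq> \<xi>" "\<xi> \<subseteq> \<beta>" for \<xi>
  proof -
    have "(\<xi> \<curlyvee> \<gamma>) \<inter> \<beta> = \<xi> \<curlyvee> (\<gamma> \<inter> \<beta>)" by (rule modular_law[OF \<xi>(1) \<gamma> \<beta> \<xi>(3)])
    also have "\<dots> = \<xi>" by (rule join_absorb) (use \<xi> in auto)
    finally have e: "\<xi> = (\<xi> \<curlyvee> \<gamma>) \<inter> \<beta>" ..
    have "\<xi> \<curlyvee> \<gamma> \<subseteq> \<beta> \<curlyvee> \<gamma>"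
      by (rule join_least[OF join_Con[OF \<beta> \<gamma>]])
        (use \<xi>(3) join_ub1[of \<beta> \<gamma>] join_ub2[of \<gamma> \<beta>] in auto)
    then have "\<xi> \<curlyvee> \<gamma> = \<gamma> \<or> \<xi> \<curlyvee> \<gamma> = \<beta> \<curlyvee> \<gamma>"
      by (rule prime_interval_cases[OF p join_Con[OF \<xi>(1) \<gamma>] join_ub2])
    then show ?thesis using e join_ub1[of \<beta> \<gamma>] by auto
  qed
  moreover have "\<not> \<beta> \<subseteq> \<gamma>"
    using prime_intervalD(4)[OF p] join_least[OF \<gamma>, of \<beta> \<gamma>] by auto
  ultimately show ?thesis
    using Int_Con[OF \<beta> \<gamma>] \<beta> unfolding prime_interval_def by auto
qed

lemma Cm_Con: "\<eta> \<in> Cm ar A \<Longrightarrow> \<eta> \<in> Con ar A"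
  by (simp add: Cm_def)

lemma cover_props:
  assumes \<eta>: "\<eta> \<in> Cm ar A"
  shows "cover \<eta> \<in> Con ar A" "\<eta> \<subset> cover \<eta>"
    "\<And>\<delta>. \<delta> \<in> Con ar A \<Longrightarrow> \<eta> \<subset> \<delta> \<Longrightarrow> cover \<eta> \<subseteq> \<delta>"
proof -
  let ?S = "{\<delta> \<in> Con ar A. \<eta> \<subset> \<delta>}"
  let ?c = "carrier A \<times> carrier A \<inter> \<Inter>?S"
  have c: "?c \<in> Con ar A" using Con_Inter[OF algebra, of ?S] by blast
  have "?S \<subseteq> Con ar A" by auto
  then have "?c = \<eta> \<longrightarrow> \<eta> \<in> ?S" using \<eta> unfolding Cm_def by blast
  then have "?c \<noteq> \<eta>" by auto
  moreover have "\<eta> \<subseteq> ?c" using Con_sub[OF Cm_Con[OF \<eta>]] by auto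
  ultimately have s: "\<eta> \<subset> ?c" by auto
  have "cover \<eta> = ?c"
    unfolding con_cover_def
  proof (rule the_equality)
    show "?c \<in> Con ar A \<and> \<eta> \<subset> ?c \<and> (\<forall>\<delta>\<in>Con ar A. \<eta> \<subset> \<delta> \<longrightarrow> ?c \<subseteq> \<delta>)"
      using c s by auto
    show "\<gamma> = ?c" if g: "\<gamma> \<in> Con ar A \<and> \<eta> \<subset> \<gamma> \<and> (\<forall>\<delta>\<in>Con ar A. \<eta> \<subset> \<delta> \<longrightarrow> \<gamma> \<subseteq> \<delta>)" for \<gamma>
    proof
      show "\<gamma> \<subseteq> ?c" using conjunct2[OF conjunct2[OF g], THEN bspec, OF c] s by simp
      have "\<gamma> \<in> ?S" using g by simp
      then show "?c \<subseteq> \<gamma>" by (rule le_infI2[OF Inter_lower])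
    qed
  qed
  with c s show "cover \<eta> \<in> Con ar A" "\<eta> \<subset> cover \<eta>"
    "\<And>\<delta>. \<delta> \<in> Con ar A \<Longrightarrow> \<eta> \<subset> \<delta> \<Longrightarrow> cover \<eta> \<subseteq> \<delta>" by auto
qed

lemma prime_cover: "\<eta> \<in> Cm ar A \<Longrightarrow> prime_interval \<eta> (cover \<eta>)"
  unfolding prime_interval_def using Cm_Con[of \<eta>] cover_props[of \<eta>] by blast

text \<open>
  A congruence that is maximal among those above \<open>\<alpha>\<close> and avoiding \<open>(x, y)\<close> is completely meet
  irreducible, because every strictly larger congruence contains \<open>(x, y)\<close>. It exists by Zorn's lemma: operations are
  finitary, so the union of a chain of congruences is a congruence.
\<close>

lemma separating_Cm:
  assumes \<alpha>: "\<alpha> \<in> Con ar A" and x: "x \<in> carrier A" and y: "y \<in> carrier A" and n: "(x, y) \<notin> \<alpha>"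
  obtains \<theta> where "\<theta> \<in> Cm ar A" "\<alpha> \<subseteq> \<theta>" "(x, y) \<notin> \<theta>"
proof -
  let ?F = "{\<theta> \<in> Con ar A. \<alpha> \<subseteq> \<theta> \<and> (x, y) \<notin> \<theta>}"
  have chain: "\<Union>C \<in> ?F" if C: "C \<noteq> {}" "subset.chain ?F C" for C
  proof -
    have CC: "\<theta> \<in> Con ar A" and CF: "\<alpha> \<subseteq> \<theta>" "(x, y) \<notin> \<theta>" if "\<theta> \<in> C" for \<theta>
      using subsetD[of C ?F \<theta>] C that by (simp_all add: subset.chain_def)
    have dir: "\<exists>\<theta>\<in>C. X \<subseteq> \<theta>" if "finite X" "X \<subseteq> \<Union>C" for X
      using finite_subset_Union_chain[OF that C] by blast
    have "\<Union>C \<in> Con ar A"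
    proof (rule ConI)
      show "equiv (carrier A) (\<Union>C)"
      proof (rule equivI_on)
        show "\<Union>C \<subseteq> carrier A \<times> carrier A" using Con_sub[OF CC] by blast
        show "(u, u) \<in> \<Union>C" if "u \<in> carrier A" for u
          using Con_refl[OF CC] C(1) that by blast
        show "(v, u) \<in> \<Union>C" if "(u, v) \<in> \<Union>C" for u v
          using Con_sym[OF CC] that by blast
        show "(u, w) \<in> \<Union>C" if uvw: "(u, v) \<in> \<Union>C" "(v, w) \<in> \<Union>C" for u v w
        proof -
          obtain \<theta> where "\<theta> \<in> C" "{(u, v), (v, w)} \<subseteq> \<theta>" using dir[of "{(u, v), (v, w)}"] uvw by auto
          then show ?thesis using Con_trans[OF CC, of \<theta> u v w] by auto
        qed
      qed
      fix f xs ys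
      assume h: "length xs = ar f" "length ys = ar f" "\<And>i. i < ar f \<Longrightarrow> (xs ! i, ys ! i) \<in> \<Union>C"
      obtain \<theta> where t: "\<theta> \<in> C" "(\<lambda>i. (xs ! i, ys ! i)) ` {..<ar f} \<subseteq> \<theta>"
        using dir[of "(\<lambda>i. (xs ! i, ys ! i)) ` {..<ar f}"] h(3) by auto
      have "(interp A f xs, interp A f ys) \<in> \<theta>"
        by (rule Con_interp[OF CC[OF t(1)] h(1,2)]) (use t(2) in auto)
      then show "(interp A f xs, interp A f ys) \<in> \<Union>C" using t(1) by blast
    qed
    moreover have "\<alpha> \<subseteq> \<Union>C" "(x, y) \<notin> \<Union>C" using C(1) CF by blast+
    ultimately show ?thesis by simp
  qed
  have "\<exists>M\<in>?F. \<forall>X\<in>?F. M \<subseteq> X \<longrightarrow> X = M"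
    by (rule subset_Zorn_nonempty) (use \<alpha> n chain in auto)
  then obtain \<theta> where t: "\<theta> \<in> ?F" and max: "\<forall>\<xi>\<in>?F. \<theta> \<subseteq> \<xi> \<longrightarrow> \<xi> = \<theta>" by (rule bexE)
  have "\<theta> \<in> Cm ar A"
    unfolding Cm_def
  proof (intro CollectI conjI allI impI)
    show "\<theta> \<in> Con ar A" using t by simp
    fix S assume S: "S \<subseteq> Con ar A" "carrier A \<times> carrier A \<inter> \<Inter> S = \<theta>"
    have "(x, y) \<notin> carrier A \<times> carrier A \<inter> \<Inter> S" using t S(2) by simp
    then obtain \<sigma> where s: "\<sigma> \<in> S" "(x, y) \<notin> \<sigma>" using x y by auto
    have "\<theta> \<subseteq> \<sigma>" using S(2) s(1) by auto
    then have "\<sigma> = \<theta>" using max[THEN bspec, of \<sigma>] S(1) s t by auto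
    then show "\<theta> \<in> S" using s by simp
  qed
  with that t show ?thesis by simp
qed

text \<open>
  Every prime interval transposes up to \<open>I[\<theta>, \<theta>\<^sup>+]\<close> for some completely meet irreducible \<open>\<theta>\<close>. Thus
  the intermediate intervals in a chain of transpositions can be replaced by intervals of this
  form.
\<close>

lemma prime_interval_Cm:
  assumes p: "prime_interval \<alpha> \<beta>"
  obtains \<theta> where "\<theta> \<in> Cm ar A" "\<beta> \<inter> \<theta> = \<alpha>" "cover \<theta> = \<beta> \<curlyvee> \<theta>"
proof -
  have c: "\<alpha> \<in> Con ar A" "\<beta> \<in> Con ar A" "\<alpha> \<subset> \<beta>" using p by (auto simp: prime_interval_def)
  then obtain x y where xy: "(x, y) \<in> \<beta>" "(x, y) \<notin> \<alpha>" by auto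
  obtain \<theta> where t: "\<theta> \<in> Cm ar A" "\<alpha> \<subseteq> \<theta>" "(x, y) \<notin> \<theta>"
    by (rule separating_Cm[OF c(1) _ _ xy(2)]) (use xy Con_sub[OF c(2)] in auto)
  have tC: "\<theta> \<in> Con ar A" by (rule Cm_Con[OF t(1)])
  have m: "\<beta> \<inter> \<theta> = \<alpha>"
    using prime_interval_cases[OF p Int_Con[OF c(2) tC]] t c xy by auto
  have "prime_interval \<theta> (\<beta> \<curlyvee> \<theta>)" using prime_transpose_up[OF _ tC] p m by simp
  then have "cover \<theta> = \<beta> \<curlyvee> \<theta>"
    using prime_interval_cases[of \<theta> "\<beta> \<curlyvee> \<theta>" "cover \<theta>"] prime_intervalD[of \<theta> "\<beta> \<curlyvee> \<theta>"]
      cover_props[OF t(1)] by auto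
  with that t m show ?thesis by blast
qed

text \<open>
  The prime intervals above \<open>\<gamma>\<close> and \<open>\<delta>\<close> have a common lower transpose \<open>I[\<beta> \<inter> \<gamma>, \<beta>]\<close>.
\<close>

definition linked :: "('a \<times> 'a) set \<Rightarrow> ('a \<times> 'a) set \<Rightarrow> bool" where
  "linked \<gamma> \<delta> \<longleftrightarrow> \<gamma> \<in> Cm ar A \<and> \<delta> \<in> Cm ar A \<and>
     (\<exists>\<beta>\<in>Con ar A. \<beta> \<inter> \<gamma> = \<beta> \<inter> \<delta> \<and> \<not> \<beta> \<subseteq> \<gamma> \<and> \<beta> \<subseteq> cover \<gamma> \<and> \<beta> \<subseteq> cover \<delta>)"

lemma linkedI:
  assumes "\<gamma> \<in> Cm ar A" "\<delta> \<in> Cm ar A" "\<beta> \<in> Con ar A" "\<beta> \<inter> \<gamma> = \<beta> \<inter> \<delta>" "\<not> \<beta> \<subseteq> \<gamma>"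
    "\<beta> \<subseteq> cover \<gamma>" "\<beta> \<subseteq> cover \<delta>"
  shows "linked \<gamma> \<delta>"
  unfolding linked_def by (intro conjI bexI[of _ \<beta>] assms)

lemma linkedE:
  assumes "linked \<gamma> \<delta>"
  obtains \<beta> where "\<gamma> \<in> Cm ar A" "\<delta> \<in> Cm ar A" "\<beta> \<in> Con ar A" "\<beta> \<inter> \<gamma> = \<beta> \<inter> \<delta>"
    "\<not> \<beta> \<subseteq> \<gamma>" "\<not> \<beta> \<subseteq> \<delta>" "\<beta> \<subseteq> cover \<gamma>" "\<beta> \<subseteq> cover \<delta>"
  using assms unfolding linked_def by (elim conjE bexE) (metis inf.absorb_iff1)

lemma linked_refl: "\<gamma> \<in> Cm ar A \<Longrightarrow> linked \<gamma> \<gamma>"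
  unfolding linked_def using cover_props(1,2)[of \<gamma>] by (intro conjI bexI[of _ "cover \<gamma>"]) auto

lemma linked_sym: "linked \<gamma> \<delta> \<Longrightarrow> linked \<delta> \<gamma>"
  by (erule linkedE, rule linkedI) auto

lemma cover_eq_join:
  assumes "\<gamma> \<in> Cm ar A" "\<beta> \<in> Con ar A" "\<not> \<beta> \<subseteq> \<gamma>" "\<beta> \<subseteq> cover \<gamma>"
  shows "\<beta> \<curlyvee> \<gamma> = cover \<gamma>"
proof
  show "\<beta> \<curlyvee> \<gamma> \<subseteq> cover \<gamma>" using join_least[of "cover \<gamma>" \<beta> \<gamma>] cover_props(1,2)[OF assms(1)] assms(4) by auto
  show "cover \<gamma> \<subseteq> \<beta> \<curlyvee> \<gamma>"
    using cover_props(3)[OF assms(1) join_Con[OF assms(2) Cm_Con[OF assms(1)]]]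
      join_ub1[of \<beta> \<gamma>] join_ub2[of \<gamma> \<beta>] assms(3) by auto
qed

lemma linked_Cm_sim:
  assumes "linked \<gamma> \<delta>"
  shows "(\<gamma>, \<delta>) \<in> Cm_sim ar A"
proof -
  obtain \<beta> where g: "\<gamma> \<in> Cm ar A" and d: "\<delta> \<in> Cm ar A"
    and b: "\<beta> \<in> Con ar A" "\<beta> \<inter> \<gamma> = \<beta> \<inter> \<delta>" "\<not> \<beta> \<subseteq> \<gamma>" "\<not> \<beta> \<subseteq> \<delta>" "\<beta> \<subseteq> cover \<gamma>" "\<beta> \<subseteq> cover \<delta>"
    using assms by (rule linkedE)
  have up: "((\<beta> \<inter> \<eta>, \<beta>), (\<eta>, cover \<eta>)) \<in> transposes_up ar A"
    if "\<eta> \<in> Cm ar A" "\<not> \<beta> \<subseteq> \<eta>" "\<beta> \<subseteq> cover \<eta>" for \<eta>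
    using that cover_eq_join[OF that(1) b(1) that(2,3)] cover_props(1,2)[OF that(1)] b(1)
      Cm_Con[OF that(1)] Int_Con[OF b(1)]
    unfolding transposes_up_def intervals_def by auto
  have "((\<gamma>, cover \<gamma>), (\<beta> \<inter> \<gamma>, \<beta>)) \<in> transposes_up ar A \<union> (transposes_up ar A)\<inverse>"
    using up[OF g b(3,5)] by simp
  moreover have "((\<beta> \<inter> \<gamma>, \<beta>), (\<delta>, cover \<delta>)) \<in> transposes_up ar A \<union> (transposes_up ar A)\<inverse>"
    using up[OF d b(4,6)] b(2) by auto
  ultimately show ?thesis
    unfolding Cm_sim_def projective_def using g d by (auto intro: rtrancl_trans)
qed

end

section \<open>Strongly Fregean algebras\<close>

locale strongly_fregean_algebra =
  fixes ar :: "'f \<Rightarrow> nat" and A :: "('f, 'a) ualg" and t :: "('f, nat) trm"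
  assumes is_alg: "is_algebra ar A" and constant_term: "constant_trm ar A t"
    and strongly_fregean: "strongly_fregean ar t A"
begin

abbreviation unit ("\<e>") where "\<e> \<equiv> const_val A t"

lemma variety_modular: "cong_modular_variety_of ar A"
  using strongly_fregean by (simp add: strongly_fregean_def)

sublocale congruence_modular ar A
proof
  show "is_algebra ar A" by (rule is_alg)
  show "modular_Con ar A"
    by (rule modular_Con_member[OF variety_modular in_variety_of_self[OF is_alg],
          where e="\<lambda>a. {Var (Inl a)}"]) (simp add: inj_on_def)
qed

text \<open>
  Singletons of one compound term with four variables embed quadruples over \<open>A\<close> into the type in
  which modularity of the variety is stated.
\<close>

lemma modular_double_pair:
  assumes \<theta>: "\<theta> \<in> Con ar A" and \<Delta>: "\<Delta> \<in> Con ar (pair_alg A \<theta>)"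
  shows "modular_Con ar (pair_alg (pair_alg A \<theta>) \<Delta>)"
proof (rule modular_Con_member[OF variety_modular,
      where e="\<lambda>((a, b), (c, d)). {Op undefined [Var (Inl a), Var (Inl b), Var (Inl c), Var (Inl d)]}"])
  show "in_variety_of ar A (pair_alg (pair_alg A \<theta>) \<Delta>)"
    by (intro in_variety_of_pair_alg in_variety_of_self algebra \<theta> \<Delta>)
qed (auto simp: inj_on_def)

lemma unit_closed: "\<e> \<in> carrier A"
  by (rule const_val_in[OF is_alg constant_term])

lemma image_fregean:
  fixes e :: "'a \<Rightarrow> 'a set"
  assumes "pull A e Id \<in> Con ar A"
  shows "fregean ar t (image_alg A e)" "const_val (image_alg A e) t = e \<e>"
  using image_alg_hom[OF is_alg assms] strongly_fregean const_val_image[OF is_alg constant_term]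
  by (auto simp: strongly_fregean_def)

text \<open>
  The condition says that the images of \<open>a\<close> and \<open>b\<close> in \<open>A/\<gamma>\<close> generate the same principal
  congruence together with the constant; orderability of \<open>A/\<gamma>\<close> identifies them.
\<close>

lemma quotient_orderable:
  assumes \<gamma>: "\<gamma> \<in> Con ar A" and ab: "a \<in> carrier A" "b \<in> carrier A"
    and eq: "\<And>\<theta>. \<theta> \<in> Con ar A \<Longrightarrow> \<gamma> \<subseteq> \<theta> \<Longrightarrow> (\<e>, a) \<in> \<theta> \<longleftrightarrow> (\<e>, b) \<in> \<theta>"
  shows "(a, b) \<in> \<gamma>"
proof -
  let ?e = "\<lambda>x. \<gamma> `` {x}"
  let ?B = "image_alg A ?e"
  have cls: "?e x = ?e y \<longleftrightarrow> (x, y) \<in> \<gamma>" if "x \<in> carrier A" "y \<in> carrier A" for x y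
    using eq_equiv_class_iff[OF Con_equiv[OF \<gamma>] that] .
  have ker: "pull A ?e Id = \<gamma>"
    using cls Con_sub[OF \<gamma>] unfolding pull_def by auto
  have ker_Con: "pull A ?e Id \<in> Con ar A" unfolding ker by (rule \<gamma>)
  note B = image_alg_hom[OF is_alg ker_Con] and F = image_fregean[OF ker_Con]
  have "(?e \<e>, ?e a) \<in> \<sigma> \<longleftrightarrow> (?e \<e>, ?e b) \<in> \<sigma>" if s: "\<sigma> \<in> Con ar ?B" for \<sigma>
  proof -
    have "pull A ?e \<sigma> \<in> Con ar A" by (rule pull_Con[OF is_alg hom_onto_alg_hom[OF B(2)] s])
    moreover have "\<gamma> \<subseteq> pull A ?e \<sigma>"
    proof clarify
      fix x y assume xy: "(x, y) \<in> \<gamma>"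
      then have c: "x \<in> carrier A" "y \<in> carrier A" using Con_sub[OF \<gamma>] by auto
      then have "?e x \<in> carrier ?B" by (simp add: image_alg_def)
      from Con_refl[OF s this] show "(x, y) \<in> pull A ?e \<sigma>" using cls[OF c] xy c by (simp add: pull_def)
    qed
    ultimately show ?thesis using eq[of "pull A ?e \<sigma>"] ab unit_closed by (simp add: pull_def)
  qed
  then have "{\<sigma> \<in> Con ar ?B. (?e \<e>, ?e a) \<in> \<sigma>} = {\<sigma> \<in> Con ar ?B. (?e \<e>, ?e b) \<in> \<sigma>}" by auto
  then have "principal_con ar ?B (const_val ?B t) (?e a) = principal_con ar ?B (const_val ?B t) (?e b)"
    unfolding principal_con_def F(2) by simp
  moreover have "?e a \<in> carrier ?B" "?e b \<in> carrier ?B" using ab by (auto simp: image_alg_def)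
  ultimately have "?e a = ?e b" using F(1) unfolding fregean_def cong_orderable_def by blast
  then show ?thesis using cls[OF ab] by simp
qed

text \<open>
  Regularity is assumed for homomorphic images with carrier in \<open>'a set\<close>; the copy of \<open>A\<close> on
  singletons is one of them.
\<close>

lemma unit_class_determines:
  assumes c: "\<alpha> \<in> Con ar A" "\<beta> \<in> Con ar A" and eq: "\<alpha> `` {\<e>} = \<beta> `` {\<e>}"
  shows "\<alpha> = \<beta>"
proof -
  let ?e = "\<lambda>x::'a. {x}"
  have inj: "inj_on ?e (carrier A)" by simp
  have "pull A ?e Id \<in> Con ar A" unfolding pull_inj[OF inj] by (rule Con_Id[OF is_alg])
  note F = image_fregean[OF this]
  have "push ?e \<theta> `` {?e \<e>} = ?e ` (\<theta> `` {\<e>})" for \<theta>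
    by (force simp: push_def)
  then have "push ?e \<alpha> = push ?e \<beta>"
    using F push_Con[OF is_alg inj] c eq unfolding fregean_def one_regular_def by simp
  then show ?thesis
    unfolding push_def by (rule inj_image_eq_iff[THEN iffD1, rotated]) (auto simp: inj_on_def)
qed

lemma unit_class_witness:
  assumes c: "\<alpha> \<in> Con ar A" "\<beta> \<in> Con ar A" and n: "\<not> \<alpha> \<subseteq> \<beta>"
  obtains x where "(\<e>, x) \<in> \<alpha>" "(\<e>, x) \<notin> \<beta>"
proof -
  have "\<alpha> `` {\<e>} \<noteq> (\<alpha> \<inter> \<beta>) `` {\<e>}"
    using unit_class_determines[OF c(1) Int_Con[OF c]] n by auto
  then show ?thesis using that by auto
qed

text \<open>
  Let \<open>(x, y) \<in> \<eta>\<^sup>+\<close> with neither \<open>x\<close> nor \<open>y\<close> in the \<open>\<eta>\<close>-class of the constant. A congruence strictly above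
  \<open>\<eta>\<close> contains \<open>(x, y)\<close>, so it relates the constant to both \<open>x\<close> and \<open>y\<close> or to neither, and \<open>\<eta>\<close> itself relates it to
  neither. By orderability of \<open>A/\<eta>\<close>, \<open>(x, y) \<in> \<eta>\<close>.
\<close>

lemma two_blocks:
  assumes \<eta>: "\<eta> \<in> Cm ar A"
  shows "(x, y) \<in> \<eta> \<longleftrightarrow> (x, y) \<in> cover \<eta> \<and> ((\<e>, x) \<in> \<eta> \<longleftrightarrow> (\<e>, y) \<in> \<eta>)"
proof
  note C = Cm_Con[OF \<eta>] and cov = cover_props[OF \<eta>]
  show "(x, y) \<in> \<eta> \<Longrightarrow> (x, y) \<in> cover \<eta> \<and> ((\<e>, x) \<in> \<eta> \<longleftrightarrow> (\<e>, y) \<in> \<eta>)"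
    using cov(2) Con_trans[OF C] Con_sym[OF C] by blast
  assume r: "(x, y) \<in> cover \<eta> \<and> ((\<e>, x) \<in> \<eta> \<longleftrightarrow> (\<e>, y) \<in> \<eta>)"
  show "(x, y) \<in> \<eta>"
  proof (cases "(\<e>, x) \<in> \<eta>")
    case True
    then show ?thesis using r Con_trans[OF C] Con_sym[OF C] by blast
  next
    case False
    show ?thesis
    proof (rule quotient_orderable[OF C])
      show "x \<in> carrier A" "y \<in> carrier A" using r Con_sub[OF cov(1)] by auto
      fix \<theta> assume t: "\<theta> \<in> Con ar A" "\<eta> \<subseteq> \<theta>"
      show "(\<e>, x) \<in> \<theta> \<longleftrightarrow> (\<e>, y) \<in> \<theta>"
      proof (cases "\<theta> = \<eta>")
        case True
        then show ?thesis using False r by simp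
      next
        case False
        then have "(x, y) \<in> \<theta>" using cov(3)[OF t(1)] t(2) r by auto
        then show ?thesis using Con_trans[OF t(1)] Con_sym[OF t(1)] by blast
      qed
    qed
  qed
qed

text \<open>
  Suppose not. By regularity there are \<open>c\<close> in the \<open>\<delta>\<close>-class of the constant \<open>\<e>\<close> but outside its
  \<open>\<gamma>\<^sup>+\<close>-class, and \<open>b\<close> in its \<open>\<beta>\<close>-class but outside its \<open>\<gamma>\<close>-class.

  The idea is easiest to see on Day terms, quaternary terms \<open>m\<^sub>0, \<dots>, m\<^sub>n\<close> leading from the first
  variable to the last with \<open>m\<^sub>i(x, y, y, x) = x\<close>, where neighbours agree on \<open>(x, x, u, u)\<close> or on
  \<open>(x, y, y, u)\<close>. Since \<open>m\<^sub>i(c, \<e>, \<e>, c) = c\<close> and, by the choice of \<open>c\<close>, \<open>\<beta>\<close> agrees with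
  \<open>\<beta> \<inter> \<gamma>\<close> on the class of \<open>c\<close>, the value \<open>m\<^sub>i(c, b, \<e>, c)\<close> is still congruent to \<open>c\<close> modulo \<open>\<gamma>\<close>. Whether the
  change of the second argument from \<open>\<e>\<close> to \<open>b\<close> is visible modulo \<open>\<gamma>\<close> does not depend on the remaining arguments as
  long as they vary by \<open>\<gamma>\<close>- and \<open>\<delta>\<close>-steps, because \<open>\<beta> \<inter> \<gamma> = \<beta> \<inter> \<delta>\<close>. Such steps lead from
  \<open>c\<close> to \<open>\<e>\<close> and from \<open>\<e>\<close> to \<open>b\<close>, so \<open>m\<^sub>i(\<e>, \<e>, b, b)\<close> and
  \<open>m\<^sub>i(\<e>, b, b, b)\<close> are \<open>\<gamma>\<close>-related for all \<open>i\<close>. Hence all \<open>m\<^sub>i(\<e>, \<e>, b, b)\<close> are \<open>\<gamma>\<close>-related, and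
  the extreme cases give the contradiction \<open>(\<e>, b) \<in> \<gamma>\<close>.

  The proof avoids terms: a term is replaced by the quadruple of its values at
  \<open>(c, \<e>, \<e>, c)\<close>, \<open>(c, b, \<e>, c)\<close>, \<open>(\<e>, \<e>, b, b)\<close>, \<open>(\<e>, b, b, b)\<close>, grouped as two elements of
  \<open>\<beta>\<close>. These quadruples live in the subalgebra \<open>G\<close> of \<open>A\<^sup>4\<close> given by the congruence \<open>\<Delta>\<close> on
  \<open>\<beta>\<close> that is generated by componentwise \<open>\<gamma>\<close>- and \<open>\<delta>\<close>-steps.
\<close>

lemma linked_cover_le:
  assumes l: "linked \<gamma> \<delta>"
  shows "\<delta> \<subseteq> cover \<gamma>"
proof (rule ccontr)
  assume nle: "\<not> \<delta> \<subseteq> cover \<gamma>"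
  obtain \<beta> where g: "\<gamma> \<in> Cm ar A" and d: "\<delta> \<in> Cm ar A" and \<beta>: "\<beta> \<in> Con ar A"
    and m: "\<beta> \<inter> \<gamma> = \<beta> \<inter> \<delta>" and n: "\<not> \<beta> \<subseteq> \<gamma>" "\<not> \<beta> \<subseteq> \<delta>"
    and le: "\<beta> \<subseteq> cover \<gamma>" "\<beta> \<subseteq> cover \<delta>"
    using l by (rule linkedE)
  note \<gamma> = Cm_Con[OF g] and \<delta> = Cm_Con[OF d]
  obtain c where c: "(\<e>, c) \<in> \<delta>" "(\<e>, c) \<notin> cover \<gamma>"
    by (rule unit_class_witness[OF \<delta> cover_props(1)[OF g] nle])
  obtain b where b: "(\<e>, b) \<in> \<beta>" "(\<e>, b) \<notin> \<gamma>"
    by (rule unit_class_witness[OF \<beta> \<gamma> n(1)])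
  have cA: "\<e> \<in> carrier A" "b \<in> carrier A" "c \<in> carrier A"
    using c b Con_sub[OF \<delta>] Con_sub[OF \<beta>] by auto
  have "\<not> \<delta> \<subseteq> \<gamma>" using nle cover_props(2)[OF g] by auto
  then have "\<gamma> \<subset> \<gamma> \<curlyvee> \<delta>" using join_ub1[of \<gamma> \<delta>] join_ub2[of \<delta> \<gamma>] by auto
  then have cov_join: "cover \<gamma> \<subseteq> \<gamma> \<curlyvee> \<delta>" by (rule cover_props(3)[OF g join_Con[OF \<gamma> \<delta>]])

  define Q where "Q = pair_alg A \<beta>"
  have Q: "is_algebra ar Q" and cQ: "carrier Q = \<beta>"
    and fst_hom: "alg_hom ar Q A fst" and snd_hom: "alg_hom ar Q A snd"
    and diag_hom: "alg_hom ar A Q (\<lambda>a. (a, a))"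
    unfolding Q_def using pair_alg_algebra[OF is_alg \<beta>] pair_alg_proj[OF \<beta>] pair_alg_diag[OF \<beta>]
    by simp_all
  define sq where "sq \<theta> = pull Q fst \<theta> \<inter> pull Q snd \<theta>" for \<theta>
  have sq_Con: "sq \<theta> \<in> Con ar Q" if "\<theta> \<in> Con ar A" for \<theta>
    unfolding sq_def by (intro Con_Int[OF Q] pull_Con[OF Q fst_hom that] pull_Con[OF Q snd_hom that])
  have sq_iff: "((x, x'), (y, y')) \<in> sq \<theta> \<longleftrightarrow>
      (x, x') \<in> \<beta> \<and> (y, y') \<in> \<beta> \<and> (x, y) \<in> \<theta> \<and> (x', y') \<in> \<theta>" for x x' y y' \<theta>
    by (auto simp: sq_def pull_def cQ)
  define \<Delta> where "\<Delta> = con_join ar Q (sq \<gamma>) (sq \<delta>)"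
  have \<Delta>: "\<Delta> \<in> Con ar Q" unfolding \<Delta>_def by (rule con_join_Con[OF Q sq_Con[OF \<gamma>] sq_Con[OF \<delta>]])

  have step: "q \<in> \<theta>" if pq: "(p, q) \<in> sq \<theta>" and p: "p \<in> \<theta>" and \<theta>: "\<theta> \<in> Con ar A" for p q \<theta>
  proof -
    obtain p1 p2 q1 q2 where e: "p = (p1, p2)" "q = (q1, q2)" by (cases p, cases q)
    then have "(q1, p1) \<in> \<theta>" "(p1, p2) \<in> \<theta>" "(p2, q2) \<in> \<theta>"
      using pq p Con_sym[OF \<theta>] by (auto simp: sq_iff)
    then show ?thesis using e Con_trans[OF \<theta>] by blast
  qed
  \<comment> \<open>The term condition: \<open>\<Delta>\<close> cannot lead out of \<open>\<beta> \<inter> \<gamma>\<close>, which equals \<open>\<beta> \<inter> \<delta>\<close>.\<close>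
  have preserve: "q \<in> \<gamma>" if pq: "(p, q) \<in> \<Delta>" and p: "p \<in> \<gamma>" for p q
  proof -
    have in\<beta>: "p \<in> \<beta>" using Con_sub[OF \<Delta>] pq by (auto simp: cQ)
    have "(p, q) \<in> (sq \<gamma> \<union> sq \<delta>)\<^sup>+"
      using con_join_trancl[OF Q sq_Con[OF \<gamma>] sq_Con[OF \<delta>]] pq unfolding \<Delta>_def by auto
    moreover have "v \<in> \<beta> \<inter> \<gamma>" if "(u, v) \<in> sq \<gamma> \<union> sq \<delta>" "u \<in> \<beta> \<inter> \<gamma>" for u v
    proof -
      have "v \<in> \<beta>" using that(1) by (auto simp: sq_def pull_def cQ)
      moreover have "v \<in> \<gamma> \<or> v \<in> \<delta>"
        using that m step[OF _ _ \<gamma>, of u v] step[OF _ _ \<delta>, of u v] by auto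
      ultimately show ?thesis using m by auto
    qed
    ultimately have "q \<in> \<beta> \<inter> \<gamma>"
      by (induction rule: trancl_induct) (use in\<beta> p in auto)
    then show ?thesis by simp
  qed

  have \<Delta>\<delta>: "(p, q) \<in> \<Delta>" if "(p, q) \<in> sq \<delta>" for p q
    using that con_join_ub2[of "sq \<delta>" ar Q "sq \<gamma>"] unfolding \<Delta>_def by auto
  \<comment> \<open>\<open>\<gamma> \<curlyvee> \<delta>\<close> lies above \<open>\<gamma>\<^sup>+\<close>, hence above \<open>\<beta>\<close>, and so relates \<open>\<e>\<close> to \<open>b\<close>.\<close>
  have diag: "((\<e>, \<e>), (b, b)) \<in> \<Delta>"
  proof -
    have "\<gamma> \<subseteq> pull A (\<lambda>a. (a, a)) \<Delta>" "\<delta> \<subseteq> pull A (\<lambda>a. (a, a)) \<Delta>"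
      using con_join_ub1[of "sq \<gamma>" ar Q "sq \<delta>"] con_join_ub2[of "sq \<delta>" ar Q "sq \<gamma>"]
        Con_sub[OF \<gamma>] Con_sub[OF \<delta>] Con_refl[OF \<beta>]
      unfolding \<Delta>_def[symmetric] by (auto simp: pull_def subset_iff sq_iff)
    then have "\<gamma> \<curlyvee> \<delta> \<subseteq> pull A (\<lambda>a. (a, a)) \<Delta>"
      by (rule join_least[OF pull_Con[OF is_alg diag_hom \<Delta>]])
    then show ?thesis using cov_join le(1) b(1) by (auto simp: pull_def)
  qed

  define G where "G = pair_alg Q \<Delta>"
  have G: "is_algebra ar G" and cG: "carrier G = \<Delta>"
    and G1: "alg_hom ar G Q fst" and G2: "alg_hom ar G Q snd"
    unfolding G_def using pair_alg_algebra[OF Q \<Delta>] pair_alg_proj[OF \<Delta>] by simp_all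
  have modG: "modular_Con ar G"
    unfolding G_def Q_def by (rule modular_double_pair[OF \<beta>]) (use \<Delta> Q_def in simp)
  define ker where "ker h = pull G h (Id_on (carrier A))" for h
  have ker_Con: "ker h \<in> Con ar G" if "alg_hom ar G A h" for h
    unfolding ker_def by (rule pull_Con[OF G that Con_Id[OF is_alg]])
  \<comment> \<open>Equality at \<open>(c, \<e>, \<e>, c)\<close>, at \<open>(\<e>, \<e>, b, b)\<close>, and at both \<open>(c, \<e>, \<e>, c)\<close>
    and \<open>(\<e>, b, b, b)\<close>; the last one must lie below \<open>\<alpha>\<^sub>G\<close> for the modular law.\<close>
  define \<alpha>\<^sub>G \<beta>\<^sub>G \<gamma>\<^sub>G where "\<alpha>\<^sub>G = ker (fst \<circ> fst)" and "\<beta>\<^sub>G = ker (fst \<circ> snd)"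
    and "\<gamma>\<^sub>G = ker (snd \<circ> snd) \<inter> \<alpha>\<^sub>G"
  have aG: "\<alpha>\<^sub>G \<in> Con ar G" and bG: "\<beta>\<^sub>G \<in> Con ar G" and cGC: "\<gamma>\<^sub>G \<in> Con ar G"
    unfolding \<alpha>\<^sub>G_def \<beta>\<^sub>G_def \<gamma>\<^sub>G_def
    by (intro Con_Int[OF G] ker_Con alg_hom_comp[OF G1 fst_hom] alg_hom_comp[OF G2 fst_hom]
        alg_hom_comp[OF G2 snd_hom])+
  have law: "con_join ar G \<gamma>\<^sub>G (\<beta>\<^sub>G \<inter> \<alpha>\<^sub>G) = con_join ar G \<gamma>\<^sub>G \<beta>\<^sub>G \<inter> \<alpha>\<^sub>G"
    using modG aG bG cGC unfolding modular_Con_def by (simp add: \<gamma>\<^sub>G_def)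

  \<comment> \<open>The quadruples of the four projections.\<close>
  define x y z u where "x = ((c, c), (\<e>, \<e>))" and "y = ((\<e>, b), (\<e>, b))"
    and "z = ((\<e>, \<e>), (b, b))" and "u = ((c, c), (b, b))"
  have x: "x \<in> \<Delta>" unfolding x_def
    by (rule \<Delta>\<delta>) (use c cA Con_sym[OF \<delta>] Con_refl[OF \<beta>] in \<open>auto simp: sq_iff\<close>)
  have y: "y \<in> \<Delta>" unfolding y_def using Con_refl[OF \<Delta>] b by (simp add: cQ)
  have z: "z \<in> \<Delta>" unfolding z_def by (rule diag)
  have u: "u \<in> \<Delta>" using Con_trans[OF \<Delta> x[unfolded x_def] diag] unfolding u_def .
  have "(x, y) \<in> \<beta>\<^sub>G" "(y, z) \<in> \<gamma>\<^sub>G" "(z, u) \<in> \<beta>\<^sub>G" "(x, u) \<in> \<alpha>\<^sub>G"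
    using x y z u cA unfolding \<alpha>\<^sub>G_def \<beta>\<^sub>G_def \<gamma>\<^sub>G_def ker_def pull_def cG
    by (auto simp: x_def y_def z_def u_def)
  moreover have "con_join ar G \<gamma>\<^sub>G \<beta>\<^sub>G \<in> Con ar G" by (rule con_join_Con[OF G cGC bG])
  note J = Con_trans[OF this] con_join_ub1[of \<gamma>\<^sub>G ar G \<beta>\<^sub>G] con_join_ub2[of \<beta>\<^sub>G ar G \<gamma>\<^sub>G]
  ultimately have "(x, u) \<in> con_join ar G \<gamma>\<^sub>G (\<beta>\<^sub>G \<inter> \<alpha>\<^sub>G)"
    unfolding law by (meson IntI J subsetD)
  then have path: "(x, u) \<in> (\<gamma>\<^sub>G \<union> \<beta>\<^sub>G \<inter> \<alpha>\<^sub>G)\<^sup>+"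
    using con_join_trancl[OF G cGC Con_Int[OF G bG aG]] by auto
  \<comment> \<open>The modular law yields the analogue of the Day terms, a path from \<open>x\<close> to \<open>u\<close> with first
    coordinate constantly \<open>c\<close>. Along it the third coordinate stays in the \<open>\<gamma>\<close>-class of \<open>\<e>\<close>.\<close>
  have inv: "fst (fst g) = c \<longrightarrow> (\<e>, fst (snd g)) \<in> \<gamma> \<longrightarrow>
        fst (fst h) = c \<and> (\<e>, fst (snd h)) \<in> \<gamma>"
    if gh: "(g, h) \<in> \<gamma>\<^sub>G \<union> \<beta>\<^sub>G \<inter> \<alpha>\<^sub>G" for g h
  proof (intro impI)
    assume g1: "fst (fst g) = c" and g2: "(\<e>, fst (snd g)) \<in> \<gamma>"
    have mem: "g \<in> \<Delta>" "h \<in> \<Delta>" and "(g, h) \<in> \<alpha>\<^sub>G"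
      using gh by (auto simp: \<alpha>\<^sub>G_def \<beta>\<^sub>G_def \<gamma>\<^sub>G_def ker_def pull_def cG)
    then have h1: "fst (fst h) = c" using g1 by (auto simp: \<alpha>\<^sub>G_def ker_def pull_def)
    \<comment> \<open>As \<open>c\<close> lies outside the class of \<open>\<e>\<close> modulo \<open>\<gamma>\<^sup>+\<close>, its \<open>\<beta>\<close>-neighbours are \<open>\<gamma>\<close>-neighbours.\<close>
    have row: "snd k \<in> \<gamma>" if k: "k \<in> \<Delta>" "fst (fst k) = c" for k
    proof -
      obtain c' w where kw: "k = ((c, c'), w)" using k(2) by (metis prod.collapse)
      then have cc: "(c, c') \<in> \<beta>" using Con_sub[OF \<Delta>] k(1) by (auto simp: cQ)
      then have cv: "(c, c') \<in> cover \<gamma>" using le by auto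
      then have "(\<e>, c') \<notin> cover \<gamma>"
        using c(2) Con_trans[OF cover_props(1)[OF g]] Con_sym[OF cover_props(1)[OF g]] by blast
      then have "(c, c') \<in> \<gamma>"
        using two_blocks[OF g, of c c'] cv c(2) cover_props(2)[OF g] by auto
      then show ?thesis using preserve[of "(c, c')" w] k(1) kw by simp
    qed
    have "(fst (snd g), fst (snd h)) \<in> \<gamma>"
      using gh
    proof
      assume "(g, h) \<in> \<beta>\<^sub>G \<inter> \<alpha>\<^sub>G"
      then have "fst (snd g) = fst (snd h)" by (auto simp: \<beta>\<^sub>G_def ker_def pull_def)
      then show ?thesis using Con_refl[OF \<gamma> Con_in2[OF \<gamma> g2]] by simp
    next
      assume "(g, h) \<in> \<gamma>\<^sub>G"
      then have "snd (snd g) = snd (snd h)" by (auto simp: \<gamma>\<^sub>G_def ker_def pull_def)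
      moreover have "(fst (snd g), snd (snd g)) \<in> \<gamma>" "(fst (snd h), snd (snd h)) \<in> \<gamma>"
        using row mem g1 h1 by simp_all
      ultimately show ?thesis using Con_trans[OF \<gamma>] Con_sym[OF \<gamma>] by metis
    qed
    then show "fst (fst h) = c \<and> (\<e>, fst (snd h)) \<in> \<gamma>" using h1 g2 Con_trans[OF \<gamma>] by blast
  qed
  from path have "fst (fst u) = c \<and> (\<e>, fst (snd u)) \<in> \<gamma>"
  proof (induction rule: trancl_induct)
    case (base v)
    then show ?case using inv[OF base] Con_refl[OF \<gamma> cA(1)] by (simp add: x_def)
  next
    case (step v w)
    then show ?case using inv[OF step(2)] by blast
  qed
  then show False using b(2) by (simp add: u_def)
qed

end

section \<open>The geometry of a similarity class\<close>

context strongly_fregean_algebra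
begin

lemma linked_cover:
  assumes l: "linked \<gamma> \<delta>"
  shows "cover \<gamma> = cover \<delta>"
proof -
  have le: "cover \<delta> \<subseteq> cover \<gamma>" if l: "linked \<gamma> \<delta>" for \<gamma> \<delta>
  proof -
    obtain \<beta> where b: "\<gamma> \<in> Cm ar A" "\<delta> \<in> Cm ar A" "\<beta> \<in> Con ar A" "\<beta> \<inter> \<gamma> = \<beta> \<inter> \<delta>"
      "\<not> \<beta> \<subseteq> \<gamma>" "\<not> \<beta> \<subseteq> \<delta>" "\<beta> \<subseteq> cover \<gamma>" "\<beta> \<subseteq> cover \<delta>"
      using l by (rule linkedE)
    have "\<beta> \<curlyvee> \<delta> \<subseteq> cover \<gamma>"
      by (rule join_least[OF cover_props(1)[OF b(1)] b(7) linked_cover_le[OF l]])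
    then show ?thesis using cover_eq_join[OF b(2,3,6,8)] by simp
  qed
  show ?thesis using le[OF l] le[OF linked_sym[OF l]] by simp
qed

lemma same_cover_antisym:
  assumes "\<gamma> \<in> Cm ar A" "\<delta> \<in> Cm ar A" "cover \<gamma> = cover \<delta>" "\<gamma> \<subseteq> \<delta>"
  shows "\<gamma> = \<delta>"
  using cover_props(2)[OF assms(2)] cover_props(3)[OF assms(1) Cm_Con[OF assms(2)]] assms(3,4) by auto

text \<open>
  Distinct congruences with a common cover join to that cover, so the interval in question
  transposes up to the prime interval below the cover.
\<close>

lemma same_cover_prime:
  assumes \<gamma>: "\<gamma> \<in> Cm ar A" and \<delta>: "\<delta> \<in> Cm ar A" and c: "cover \<gamma> = cover \<delta>" and n: "\<gamma> \<noteq> \<delta>"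
  shows "prime_interval (\<gamma> \<inter> \<delta>) \<gamma>"
proof (rule prime_transpose_down[OF _ Cm_Con[OF \<gamma>]])
  have "\<not> \<gamma> \<subseteq> \<delta>" using same_cover_antisym[OF \<gamma> \<delta> c] n by auto
  moreover have "\<gamma> \<subseteq> cover \<delta>" using cover_props(2)[OF \<gamma>] c by auto
  ultimately have "\<gamma> \<curlyvee> \<delta> = cover \<delta>" by (rule cover_eq_join[OF \<delta> Cm_Con[OF \<gamma>]])
  then show "prime_interval \<delta> (\<gamma> \<curlyvee> \<delta>)" using prime_cover[OF \<delta>] by simp
qed

lemma bullet_iff:
  assumes "\<eta> \<in> Cm ar A"
  shows "(x, y) \<in> bullet ar A \<eta> \<phi> \<psi> \<longleftrightarrow> (x, y) \<in> cover \<eta> \<and> ((x, y) \<in> \<phi> \<longleftrightarrow> (x, y) \<in> \<psi>)"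
  using Con_sub[OF cover_props(1)[OF assms]] by (auto simp: bullet_def)

text \<open>
  Joining the congruence \<open>\<beta>\<close> that links \<open>\<gamma>\<close> and \<open>\<delta>\<close> with \<open>\<gamma> \<inter> \<delta>\<close> gives \<open>\<kappa>\<close>, the third middle element
  of a diamond between \<open>\<gamma> \<inter> \<delta>\<close> and the common cover. A completely meet irreducible \<open>\<theta>\<close> to which \<open>I[\<kappa>, \<gamma>\<^sup>+]\<close>
  transposes up is linked to \<open>\<delta>\<close>, so its cover is \<open>\<gamma>\<^sup>+\<close> and \<open>\<theta> = \<kappa>\<close>. Now \<open>\<gamma>\<close>, \<open>\<delta>\<close> and \<open>\<kappa>\<close> are given by
  two-block partitions of the class of \<open>\<e>\<close>. Any two of the three meet in \<open>\<gamma> \<inter> \<delta>\<close>, which forces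
  the block of \<open>\<e>\<close> in \<open>\<kappa>\<close> to consist of the elements on which the other two partitions agree.
\<close>

lemma linked_bullet:
  assumes l: "linked \<gamma> \<delta>" and ne: "\<gamma> \<noteq> \<delta>"
  shows "linked (bullet ar A \<gamma> \<gamma> \<delta>) \<delta>"
proof -
  obtain \<beta> where g: "\<gamma> \<in> Cm ar A" and d: "\<delta> \<in> Cm ar A" and b: "\<beta> \<in> Con ar A" "\<beta> \<inter> \<gamma> = \<beta> \<inter> \<delta>"
      "\<not> \<beta> \<subseteq> \<gamma>" "\<not> \<beta> \<subseteq> \<delta>" "\<beta> \<subseteq> cover \<gamma>" "\<beta> \<subseteq> cover \<delta>"
    using l by (rule linkedE)
  note \<gamma> = Cm_Con[OF g] and \<delta> = Cm_Con[OF d] and c = linked_cover[OF l]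
  note sub = cover_props(2)[OF g] cover_props(2)[OF d, folded c]
  note meet = Int_Con[OF \<gamma> \<delta>]
  define \<kappa> where "\<kappa> = (\<gamma> \<inter> \<delta>) \<curlyvee> \<beta>"
  have \<kappa>: "\<kappa> \<in> Con ar A" unfolding \<kappa>_def by (rule join_Con[OF meet b(1)])
  have low: "\<gamma> \<inter> \<delta> \<subseteq> \<kappa>" and \<beta>\<kappa>: "\<beta> \<subseteq> \<kappa>"
    unfolding \<kappa>_def by (rule join_ub1, rule join_ub2)
  have up: "\<kappa> \<subseteq> cover \<gamma>"
    unfolding \<kappa>_def by (rule join_least[OF cover_props(1)[OF g]]) (use sub b in auto)
  have \<kappa>g: "\<kappa> \<inter> \<gamma> = \<gamma> \<inter> \<delta>"
    unfolding \<kappa>_def modular_law[OF meet b(1) \<gamma> Int_lower1]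
    by (rule join_absorb[OF meet]) (use b(2) in auto)
  have \<kappa>d: "\<kappa> \<inter> \<delta> = \<gamma> \<inter> \<delta>"
    unfolding \<kappa>_def modular_law[OF meet b(1) \<delta> Int_lower2]
    by (rule join_absorb[OF meet]) (use b(2) in auto)
  have n\<kappa>: "\<not> \<kappa> \<subseteq> \<gamma>" using b(3) \<beta>\<kappa> by auto
  have "\<kappa> \<curlyvee> \<gamma> = cover \<gamma>" by (rule cover_eq_join[OF g \<kappa> n\<kappa> up])
  then have "prime_interval \<kappa> (cover \<gamma>)"
    using prime_transpose_up[OF _ \<kappa>, of \<gamma>] same_cover_prime[OF g d c ne] \<kappa>g
    by (simp add: Int_commute join_comm)
  then obtain \<theta> where th: "\<theta> \<in> Cm ar A" "cover \<gamma> \<inter> \<theta> = \<kappa>" "cover \<theta> = cover \<gamma> \<curlyvee> \<theta>"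
    by (rule prime_interval_Cm)
  have "linked \<theta> \<delta>"
  proof (rule linkedI[OF th(1) d \<gamma>])
    have "\<gamma> \<inter> \<theta> = \<gamma> \<inter> (cover \<gamma> \<inter> \<theta>)" using sub by auto
    then show m: "\<gamma> \<inter> \<theta> = \<gamma> \<inter> \<delta>" using th(2) \<kappa>g by auto
    have "\<not> \<gamma> \<subseteq> \<delta>" using same_cover_antisym[OF g d c] ne by auto
    then show "\<not> \<gamma> \<subseteq> \<theta>" using m by auto
    show "\<gamma> \<subseteq> cover \<theta>" using th(3) join_ub1[of "cover \<gamma>" \<theta>] sub by auto
    show "\<gamma> \<subseteq> cover \<delta>" using sub c by auto
  qed
  moreover from linked_cover[OF this] have c\<theta>: "cover \<theta> = cover \<gamma>" using c by simp
  with th(2) cover_props(2)[OF th(1)] have \<theta>\<kappa>: "\<theta> = \<kappa>" by auto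
  moreover have "\<kappa> = bullet ar A \<gamma> \<gamma> \<delta>"
  proof -
    have blocks\<kappa>: "(x, y) \<in> \<kappa> \<longleftrightarrow> (x, y) \<in> cover \<gamma> \<and> ((\<e>, x) \<in> \<kappa> \<longleftrightarrow> (\<e>, y) \<in> \<kappa>)" for x y
      using two_blocks[OF th(1), of x y] c\<theta> \<theta>\<kappa> by simp
    note blocks = blocks\<kappa> two_blocks[OF g] two_blocks[OF d, folded c]
    obtain b' where b': "(\<e>, b') \<in> \<kappa>" "(\<e>, b') \<notin> \<gamma>" by (rule unit_class_witness[OF \<kappa> \<gamma> n\<kappa>])
    then have b'd: "(\<e>, b') \<notin> \<delta>" using \<kappa>g \<kappa>d by auto
    note E = cover_props(1)[OF g]
    have unit: "(\<e>, x) \<in> \<kappa> \<longleftrightarrow> ((\<e>, x) \<in> \<gamma> \<longleftrightarrow> (\<e>, x) \<in> \<delta>)" if x: "(\<e>, x) \<in> cover \<gamma>" for x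
    proof
      show "(\<e>, x) \<in> \<kappa> \<Longrightarrow> (\<e>, x) \<in> \<gamma> \<longleftrightarrow> (\<e>, x) \<in> \<delta>" using \<kappa>g \<kappa>d by auto
      assume iff: "(\<e>, x) \<in> \<gamma> \<longleftrightarrow> (\<e>, x) \<in> \<delta>"
      show "(\<e>, x) \<in> \<kappa>"
      proof (cases "(\<e>, x) \<in> \<gamma>")
        case True
        then show ?thesis using iff low by auto
      next
        case False
        \<comment> \<open>Both \<open>b'\<close> and \<open>x\<close> lie in the second block of \<open>\<gamma>\<close> and in that of \<open>\<delta>\<close>.\<close>
        have "(b', x) \<in> cover \<gamma>"
          using Con_trans[OF E Con_sym[OF E] x] b'(1) up by auto
        then have "(b', x) \<in> \<gamma> \<inter> \<delta>" using False iff b'(2) b'd blocks(2,3)[of b' x] by auto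
        then show ?thesis using low Con_trans[OF \<kappa> b'(1)] by auto
      qed
    qed
    have "(x, y) \<in> \<kappa> \<longleftrightarrow> (x, y) \<in> cover \<gamma> \<and> ((x, y) \<in> \<gamma> \<longleftrightarrow> (x, y) \<in> \<delta>)" for x y
    proof (cases "(x, y) \<in> cover \<gamma>")
      case False
      then show ?thesis using up by auto
    next
      case xy: True
      show ?thesis
      proof (cases "(\<e>, x) \<in> cover \<gamma>")
        case True
        then have "(\<e>, y) \<in> cover \<gamma>" using Con_trans[OF E _ xy] by auto
        then show ?thesis using unit[OF True] unit[of y] blocks[of x y] by argo
      next
        case False
        then have "(\<e>, y) \<notin> cover \<gamma>" using Con_trans[OF E _ Con_sym[OF E xy]] by auto
        then show ?thesis using False blocks[of x y] sub up by auto
      qed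
    qed
    then show ?thesis using bullet_iff[OF g] by auto
  qed
  ultimately show ?thesis by simp
qed

lemma bullet_cover_cong: "cover \<eta> = cover \<theta> \<Longrightarrow> bullet ar A \<eta> = bullet ar A \<theta>"
  by (simp add: bullet_def fun_eq_iff)

text \<open>
  This is the Veblen-Young argument read in the dual lattice. With \<open>\<sigma> = \<phi> \<bullet> \<psi>\<close> and \<open>\<tau> = \<psi> \<bullet> \<chi>\<close>, every pair in
  \<open>\<sigma> \<inter> \<tau>\<close> belongs to \<open>\<phi> \<bullet> \<chi>\<close>, so \<open>\<sigma> \<inter> \<tau>\<close> meets \<open>\<phi>\<close> and \<open>\<chi>\<close> in the same congruence and
  links them unless it lies below \<open>\<phi>\<close>. In that case \<open>\<phi>\<close> is a point of the line through \<open>\<sigma>\<close> and \<open>\<tau>\<close>: either it is \<open>\<tau>\<close>,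
  which is linked to \<open>\<chi>\<close>, or \<open>\<phi> \<inter> \<sigma> = \<phi> \<inter> \<tau>\<close>, which forces \<open>\<phi> \<subseteq> \<chi>\<close> and so \<open>\<phi> = \<chi>\<close>.
\<close>

lemma linked_trans:
  assumes l1: "linked \<phi> \<psi>" and l2: "linked \<psi> \<chi>"
  shows "linked \<phi> \<chi>"
proof -
  have Cm: "\<phi> \<in> Cm ar A" "\<psi> \<in> Cm ar A" "\<chi> \<in> Cm ar A"
    using l1 l2 by (auto simp: linked_def)
  have c: "cover \<psi> = cover \<phi>" "cover \<chi> = cover \<phi>"
    using linked_cover[OF l1] linked_cover[OF l2] by auto
  note sub = cover_props(2)[OF Cm(1)] cover_props(2)[OF Cm(2), unfolded c]
    cover_props(2)[OF Cm(3), unfolded c]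
  show ?thesis
  proof (cases "\<phi> = \<psi> \<or> \<psi> = \<chi> \<or> \<phi> = \<chi>")
    case True
    then show ?thesis using l1 l2 linked_refl[OF Cm(1)] by auto
  next
    case False
    define \<sigma> \<tau> where "\<sigma> = bullet ar A \<phi> \<phi> \<psi>" and "\<tau> = bullet ar A \<phi> \<psi> \<chi>"
    have \<sigma>: "(x, y) \<in> \<sigma> \<longleftrightarrow> (x, y) \<in> cover \<phi> \<and> ((x, y) \<in> \<phi> \<longleftrightarrow> (x, y) \<in> \<psi>)"
      and \<tau>: "(x, y) \<in> \<tau> \<longleftrightarrow> (x, y) \<in> cover \<phi> \<and> ((x, y) \<in> \<psi> \<longleftrightarrow> (x, y) \<in> \<chi>)" for x y
      unfolding \<sigma>_def \<tau>_def by (rule bullet_iff[OF Cm(1)])+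
    have l\<sigma>: "linked \<sigma> \<psi>" unfolding \<sigma>_def by (rule linked_bullet[OF l1]) (use False in auto)
    have l\<tau>: "linked \<tau> \<chi>"
      unfolding \<tau>_def bullet_cover_cong[OF c(1), symmetric] by (rule linked_bullet[OF l2]) (use False in auto)
    have Cm': "\<sigma> \<in> Cm ar A" "\<tau> \<in> Cm ar A" using l\<sigma> l\<tau> by (auto simp: linked_def)
    have c': "cover \<sigma> = cover \<phi>" "cover \<tau> = cover \<phi>"
      using linked_cover[OF l\<sigma>] linked_cover[OF l\<tau>] c by auto
    show ?thesis
    proof (cases "\<phi> = \<tau>")
      case True
      then show ?thesis using l\<tau> by simp
    next
      case ne\<tau>: False
      have ne\<sigma>: "\<phi> \<noteq> \<sigma>"
      proof
        assume "\<phi> = \<sigma>"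
        then have "cover \<phi> \<subseteq> \<psi>" using \<sigma> by auto
        then show False using sub by auto
      qed
      have ne: "\<sigma> \<noteq> \<tau>"
      proof
        assume e: "\<sigma> = \<tau>"
        have "(x, y) \<in> \<phi> \<longleftrightarrow> (x, y) \<in> \<chi>" for x y
          using \<sigma>[of x y] \<tau>[of x y] e sub by auto
        then show False using False by auto
      qed
      show ?thesis
      proof (rule linkedI[OF Cm(1,3) Int_Con[OF Cm'[THEN Cm_Con]]])
        show "\<sigma> \<inter> \<tau> \<inter> \<phi> = \<sigma> \<inter> \<tau> \<inter> \<chi>" using \<sigma> \<tau> by auto
        show "\<sigma> \<inter> \<tau> \<subseteq> cover \<phi>" "\<sigma> \<inter> \<tau> \<subseteq> cover \<chi>" using \<sigma> c by auto
        show "\<not> \<sigma> \<inter> \<tau> \<subseteq> \<phi>"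
        proof
          assume le: "\<sigma> \<inter> \<tau> \<subseteq> \<phi>"
          have eq: "\<phi> \<inter> \<mu> = \<mu> \<inter> \<nu>"
            if h: "\<mu> \<in> Cm ar A" "\<nu> \<in> Cm ar A" "cover \<mu> = cover \<phi>" "cover \<nu> = cover \<phi>"
              "\<mu> \<noteq> \<nu>" "\<phi> \<noteq> \<mu>" "\<mu> \<inter> \<nu> \<subseteq> \<phi>" for \<mu> \<nu>
          proof -
            have "\<phi> \<inter> \<mu> = \<mu> \<inter> \<nu> \<or> \<phi> \<inter> \<mu> = \<mu>"
              by (rule prime_interval_cases[OF same_cover_prime[OF h(1,2) _ h(5)]])
                (use h Int_Con[OF Cm_Con[OF Cm(1)] Cm_Con[OF h(1)]] in auto)
            moreover have "\<phi> \<inter> \<mu> \<noteq> \<mu>"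
              using same_cover_antisym[OF h(1) Cm(1) h(3)] h(6) by auto
            ultimately show ?thesis by simp
          qed
          have "\<phi> \<inter> \<sigma> = \<sigma> \<inter> \<tau>" by (rule eq) (use Cm' c' ne ne\<sigma> le in auto)
          moreover have "\<phi> \<inter> \<tau> = \<tau> \<inter> \<sigma>" by (rule eq) (use Cm' c' ne ne\<tau> le in auto)
          ultimately have same: "\<phi> \<inter> \<sigma> = \<phi> \<inter> \<tau>" by auto
          have "(x, y) \<in> \<chi>" if "(x, y) \<in> \<phi>" for x y
            using that same \<sigma>[of x y] \<tau>[of x y] sub by auto
          then have "\<phi> \<subseteq> \<chi>" by auto
          then show False using same_cover_antisym[OF Cm(1,3) c(2)[symmetric]] False by simp
        qed
      qed
    qed
  qed
qed

text \<open>
  The invariant concerns every completely meet irreducible \<open>\<mu>\<close> such that the current interval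
  \<open>I[\<alpha>, \<beta>]\<close> transposes up to \<open>I[\<mu>, \<mu>\<^sup>+]\<close>. An upward step only removes such \<open>\<mu>\<close>. A downward step may add some, but
  keeps the old ones, of which there is at least one; the interval reached by the step links it to each new \<open>\<mu>\<close>.
\<close>

lemma projective_linked:
  assumes \<phi>: "\<phi> \<in> Cm ar A" and pr: "((\<phi>, cover \<phi>), J) \<in> projective ar A"
  shows "prime_interval (fst J) (snd J) \<and>
    (\<forall>\<mu>\<in>Cm ar A. snd J \<inter> \<mu> = fst J \<longrightarrow> snd J \<subseteq> cover \<mu> \<longrightarrow> linked \<phi> \<mu>)"
  using pr unfolding projective_def
proof (induction rule: rtrancl_induct)
  case base
  have "linked \<phi> \<mu>" if m: "\<mu> \<in> Cm ar A" "cover \<phi> \<inter> \<mu> = \<phi>" for \<mu>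
  proof -
    have "\<phi> = \<mu>"
    proof (rule ccontr)
      assume "\<phi> \<noteq> \<mu>"
      then have "cover \<phi> \<subseteq> \<mu>" using cover_props(3)[OF \<phi> Cm_Con[OF m(1)]] m(2) by auto
      then show False using m(2) cover_props(2)[OF \<phi>] by auto
    qed
    then show ?thesis using linked_refl[OF \<phi>] by simp
  qed
  then show ?case using prime_cover[OF \<phi>] by simp
next
  case (step J K)
  have down: "\<beta> \<inter> \<mu> = \<beta> \<inter> \<gamma>" "\<beta> \<subseteq> cover \<mu>"
    if "(\<beta> \<curlyvee> \<gamma>) \<inter> \<mu> = \<gamma>" "\<beta> \<curlyvee> \<gamma> \<subseteq> cover \<mu>" for \<beta> \<gamma> \<mu>
    using that join_ub1[of \<beta> \<gamma>] by auto
  obtain \<alpha> \<beta> \<gamma> \<delta> where J: "J = (\<alpha>, \<beta>)" and K: "K = (\<gamma>, \<delta>)" by (cases J, cases K)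
  from step(2) have "(J, K) \<in> transposes_up ar A \<or> (K, J) \<in> transposes_up ar A" by auto
  then show ?case
  proof
    assume "(J, K) \<in> transposes_up ar A"
    then have t: "\<gamma> \<in> Con ar A" "\<alpha> = \<beta> \<inter> \<gamma>" "\<delta> = \<beta> \<curlyvee> \<gamma>"
      unfolding J K transposes_up_def intervals_def by auto
    have "prime_interval \<gamma> \<delta>"
      unfolding t(3) by (rule prime_transpose_up[OF _ t(1)]) (use step.IH J t(2) in simp)
    moreover have "linked \<phi> \<mu>" if "\<mu> \<in> Cm ar A" "\<delta> \<inter> \<mu> = \<gamma>" "\<delta> \<subseteq> cover \<mu>" for \<mu>
      using step.IH that(1) down[OF that(2,3)[unfolded t(3)]] J t(2) by simp
    ultimately show ?thesis using K by simp
  next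
    assume "(K, J) \<in> transposes_up ar A"
    then have t: "\<delta> \<in> Con ar A" "\<gamma> = \<delta> \<inter> \<alpha>" "\<beta> = \<delta> \<curlyvee> \<alpha>"
      unfolding J K transposes_up_def intervals_def by auto
    have pJ: "prime_interval \<alpha> \<beta>" using step.IH J by simp
    have pK: "prime_interval \<gamma> \<delta>"
      unfolding t(2) by (rule prime_transpose_down[OF _ t(1)]) (use pJ t(3) in simp)
    obtain \<nu> where n: "\<nu> \<in> Cm ar A" "\<beta> \<inter> \<nu> = \<alpha>" "cover \<nu> = \<beta> \<curlyvee> \<nu>"
      using pJ by (rule prime_interval_Cm)
    have n\<beta>: "\<beta> \<subseteq> cover \<nu>" using n(3) join_ub1 by simp
    have l: "linked \<phi> \<nu>" using step.IH J n n\<beta> by simp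
    have nK: "\<delta> \<inter> \<nu> = \<gamma>" "\<delta> \<subseteq> cover \<nu>"
      using down[of \<delta> \<alpha> \<nu>] n(2) n\<beta> t by simp_all
    have "linked \<phi> \<mu>" if m: "\<mu> \<in> Cm ar A" "\<delta> \<inter> \<mu> = \<gamma>" "\<delta> \<subseteq> cover \<mu>" for \<mu>
    proof (rule linked_trans[OF l])
      show "linked \<nu> \<mu>"
        by (rule linkedI[OF n(1) m(1) t(1)]) (use nK m prime_intervalD(4)[OF pK] in auto)
    qed
    then show ?thesis using K pK by simp
  qed
qed

lemma Cm_sim_iff_linked: "(\<phi>, \<psi>) \<in> Cm_sim ar A \<longleftrightarrow> linked \<phi> \<psi>"
proof
  assume s: "(\<phi>, \<psi>) \<in> Cm_sim ar A"
  then have Cm: "\<phi> \<in> Cm ar A" "\<psi> \<in> Cm ar A"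
    and pr: "((\<phi>, cover \<phi>), (\<psi>, cover \<psi>)) \<in> projective ar A"
    by (auto simp: Cm_sim_def)
  show "linked \<phi> \<psi>"
    using projective_linked[OF Cm(1) pr] Cm(2) cover_props(2)[OF Cm(2)] by auto
qed (rule linked_Cm_sim)

lemma sim_classD:
  assumes "\<phi> \<in> sim_class ar A \<eta>"
  shows "linked \<eta> \<phi>" "\<eta> \<in> Cm ar A" "\<phi> \<in> Cm ar A" "cover \<phi> = cover \<eta>" "\<phi> \<subset> cover \<eta>"
proof -
  show l: "linked \<eta> \<phi>" using assms by (simp add: sim_class_def Cm_sim_iff_linked)
  then show "\<eta> \<in> Cm ar A" and p: "\<phi> \<in> Cm ar A" by (auto simp: linked_def)
  show c: "cover \<phi> = cover \<eta>" using linked_cover[OF l] by simp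
  show "\<phi> \<subset> cover \<eta>" using cover_props(2)[OF p] c by simp
qed

lemma bullet_closed:
  assumes \<eta>: "\<eta> \<in> Cm ar A" and xy: "\<phi> \<in> carrier (bar_group ar A \<eta>)" "\<psi> \<in> carrier (bar_group ar A \<eta>)"
  shows "bullet ar A \<eta> \<phi> \<psi> \<in> carrier (bar_group ar A \<eta>)"
proof -
  note sub = Con_sub[OF cover_props(1)[OF \<eta>]]
  let ?U = "sim_class ar A \<eta>"
  have le: "\<phi> \<subseteq> cover \<eta>" "\<psi> \<subseteq> cover \<eta>"
    using xy sim_classD(5) by (auto simp: bar_group_def bar_def)
  consider "\<phi> = cover \<eta>" | "\<psi> = cover \<eta>" | "\<phi> = \<psi>" | "\<phi> \<in> ?U" "\<psi> \<in> ?U" "\<phi> \<noteq> \<psi>"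
    using xy by (auto simp: bar_group_def bar_def)
  then show ?thesis
  proof cases
    case 1
    then have "bullet ar A \<eta> \<phi> \<psi> = \<psi>" using le sub by (auto simp: bullet_def)
    then show ?thesis using xy by simp
  next
    case 2
    then have "bullet ar A \<eta> \<phi> \<psi> = \<phi>" using le sub by (auto simp: bullet_def)
    then show ?thesis using xy by simp
  next
    case 3
    then have "bullet ar A \<eta> \<phi> \<psi> = cover \<eta>" using le sub by (auto simp: bullet_def)
    then show ?thesis by (simp add: bar_group_def bar_def)
  next
    case 4
    note L = sim_classD(1)[OF 4(1)] sim_classD(1)[OF 4(2)]
    have "linked (bullet ar A \<phi> \<phi> \<psi>) \<psi>"
      by (rule linked_bullet[OF linked_trans[OF linked_sym[OF L(1)] L(2)] 4(3)])
    then have "linked \<eta> (bullet ar A \<phi> \<phi> \<psi>)" by (rule linked_trans[OF L(2) linked_sym])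
    then show ?thesis
      using bullet_cover_cong[OF sim_classD(4)[OF 4(1)]]
      by (simp add: bar_group_def bar_def sim_class_def Cm_sim_iff_linked)
  qed
qed

lemma bar_group_Boolean:
  assumes \<eta>: "\<eta> \<in> Cm ar A"
  shows "group (bar_group ar A \<eta>)"
    "\<And>\<phi>. \<phi> \<in> carrier (bar_group ar A \<eta>) \<Longrightarrow> \<phi> \<otimes>\<^bsub>bar_group ar A \<eta>\<^esub> \<phi> = \<one>\<^bsub>bar_group ar A \<eta>\<^esub>"
proof -
  let ?G = "bar_group ar A \<eta>"
  note sub = Con_sub[OF cover_props(1)[OF \<eta>]]
  have m: "x \<otimes>\<^bsub>?G\<^esub> y = bullet ar A \<eta> x y" and o: "\<one>\<^bsub>?G\<^esub> = cover \<eta>" for x y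
    by (simp_all add: bar_group_def)
  have le: "x \<subseteq> cover \<eta>" if "x \<in> carrier ?G" for x
    using that sim_classD(5) by (auto simp: bar_group_def bar_def)
  have sq: "bullet ar A \<eta> x x = cover \<eta>" for x using sub by (auto simp: bullet_def)
  show "\<phi> \<otimes>\<^bsub>?G\<^esub> \<phi> = \<one>\<^bsub>?G\<^esub>" for \<phi> unfolding m o by (rule sq)
  show "group ?G"
  proof (rule groupI)
    show "x \<otimes>\<^bsub>?G\<^esub> y \<in> carrier ?G" if "x \<in> carrier ?G" "y \<in> carrier ?G" for x y
      unfolding m by (rule bullet_closed[OF \<eta> that])
    show "\<one>\<^bsub>?G\<^esub> \<in> carrier ?G" by (simp add: bar_group_def bar_def)
    show "x \<otimes>\<^bsub>?G\<^esub> y \<otimes>\<^bsub>?G\<^esub> z = x \<otimes>\<^bsub>?G\<^esub> (y \<otimes>\<^bsub>?G\<^esub> z)" for x y z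
      unfolding m using bullet_iff[OF \<eta>] by auto
    show "\<one>\<^bsub>?G\<^esub> \<otimes>\<^bsub>?G\<^esub> x = x" if "x \<in> carrier ?G" for x
      unfolding m o using le[OF that] bullet_iff[OF \<eta>] by auto
    show "\<exists>y\<in>carrier ?G. y \<otimes>\<^bsub>?G\<^esub> x = \<one>\<^bsub>?G\<^esub>" if "x \<in> carrier ?G" for x
      unfolding m o using that sq by auto
  qed
qed

end


section \<open>Hyperplanes of Boolean groups\<close>

text \<open>
  \<open>H\<close> is the kernel of a homomorphism from \<open>G\<close> to the group of order two, the trivial one included.
\<close>

definition boolean_character :: "'g set \<Rightarrow> 'g monoid \<Rightarrow> bool" where
  "boolean_character H G \<longleftrightarrow> H \<subseteq> carrier G \<and> \<one>\<^bsub>G\<^esub> \<in> H \<and>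
     (\<forall>x\<in>carrier G. \<forall>y\<in>carrier G. x \<otimes>\<^bsub>G\<^esub> y \<in> H \<longleftrightarrow> (x \<in> H \<longleftrightarrow> y \<in> H))"

text \<open>
  In a Boolean group, \<open>H \<union> x H\<close> is a subgroup for every subgroup \<open>H\<close> and every \<open>x\<close>. If \<open>H\<close> is maximal, this is the whole group
  for \<open>x \<notin> H\<close>, so the product of two elements outside \<open>H\<close> falls into \<open>H\<close>.
\<close>

lemma boolean_character_iff:
  assumes "group G" and sq: "\<And>x. x \<in> carrier G \<Longrightarrow> x \<otimes>\<^bsub>G\<^esub> x = \<one>\<^bsub>G\<^esub>"
  shows "H = carrier G \<or> hyperplane H G \<longleftrightarrow> boolean_character H G"
proof -
  interpret group G by fact
  have invx: "inv\<^bsub>G\<^esub> x = x" if "x \<in> carrier G" for x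
    using inv_equality[OF sq[OF that] that that] .
  have cancel: "x \<otimes>\<^bsub>G\<^esub> (x \<otimes>\<^bsub>G\<^esub> y) = y" if "x \<in> carrier G" "y \<in> carrier G" for x y
    using that sq by (simp flip: m_assoc)
  have comm: "x \<otimes>\<^bsub>G\<^esub> y = y \<otimes>\<^bsub>G\<^esub> x" if "x \<in> carrier G" "y \<in> carrier G" for x y
    using that inv_mult_group[of x y] invx by simp
  have subI: "subgroup K G" if "K \<subseteq> carrier G" "\<one>\<^bsub>G\<^esub> \<in> K" "\<And>x y. x \<in> K \<Longrightarrow> y \<in> K \<Longrightarrow> x \<otimes>\<^bsub>G\<^esub> y \<in> K" for K
    using that invx by (intro subgroup.intro) (auto simp: subset_iff)
  have mixed: "x \<otimes>\<^bsub>G\<^esub> y \<notin> K" if K: "subgroup K G" "x \<in> K" "y \<in> carrier G" "y \<notin> K" for K x y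
  proof
    assume "x \<otimes>\<^bsub>G\<^esub> y \<in> K"
    then have "x \<otimes>\<^bsub>G\<^esub> (x \<otimes>\<^bsub>G\<^esub> y) \<in> K" by (rule subgroup.m_closed[OF K(1,2)])
    then show False using cancel[OF subgroup.mem_carrier[OF K(1,2)] K(3)] K(4) by simp
  qed
  show ?thesis
  proof
    assume "H = carrier G \<or> hyperplane H G"
    then show "boolean_character H G"
    proof
      assume "H = carrier G"
      then show ?thesis by (simp add: boolean_character_def)
    next
      assume h: "hyperplane H G"
      then have s: "subgroup H G" by (simp add: hyperplane_def)
      note Hc = subgroup.mem_carrier[OF s] and Hm = subgroup.m_closed[OF s]
      have out: "x \<otimes>\<^bsub>G\<^esub> y \<in> H" if x: "x \<in> carrier G" "x \<notin> H" and y: "y \<in> carrier G" "y \<notin> H" for x y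
      proof -
        let ?K = "H \<union> (\<lambda>k. x \<otimes>\<^bsub>G\<^esub> k) ` H"
        have "subgroup ?K G"
        proof (rule subI)
          show "?K \<subseteq> carrier G" using Hc x by auto
          show "\<one>\<^bsub>G\<^esub> \<in> ?K" using subgroup.one_closed[OF s] by simp
          fix u v assume "u \<in> ?K" "v \<in> ?K"
          moreover have "u \<otimes>\<^bsub>G\<^esub> v \<in> H" if "u \<in> H" "v \<in> H" for u v using Hm that .
          moreover have "u \<otimes>\<^bsub>G\<^esub> (x \<otimes>\<^bsub>G\<^esub> v) = x \<otimes>\<^bsub>G\<^esub> (u \<otimes>\<^bsub>G\<^esub> v)" if "u \<in> H" "v \<in> H" for u v
            using that Hc x comm[of u x] by (metis m_assoc)
          moreover have "x \<otimes>\<^bsub>G\<^esub> u \<otimes>\<^bsub>G\<^esub> v = x \<otimes>\<^bsub>G\<^esub> (u \<otimes>\<^bsub>G\<^esub> v)" if "u \<in> H" "v \<in> H" for u v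
            using that Hc x by (simp add: m_assoc)
          moreover have "x \<otimes>\<^bsub>G\<^esub> u \<otimes>\<^bsub>G\<^esub> (x \<otimes>\<^bsub>G\<^esub> v) = u \<otimes>\<^bsub>G\<^esub> v" if "u \<in> H" "v \<in> H" for u v
            using that Hc x comm[of x u] cancel[of x v] m_assoc[of u x "x \<otimes>\<^bsub>G\<^esub> v"] by simp
          ultimately show "u \<otimes>\<^bsub>G\<^esub> v \<in> ?K" by auto
        qed
        moreover have "x \<in> ?K" using subgroup.one_closed[OF s] x by force
        ultimately have "?K = carrier G" using h x by (auto simp: hyperplane_def)
        then obtain k where "k \<in> H" "y = x \<otimes>\<^bsub>G\<^esub> k" using y by auto
        then show ?thesis using cancel[OF x(1) Hc] by simp
      qed
      have "x \<otimes>\<^bsub>G\<^esub> y \<in> H \<longleftrightarrow> (x \<in> H \<longleftrightarrow> y \<in> H)" if xy: "x \<in> carrier G" "y \<in> carrier G" for x y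
        using xy out[of x y] Hm[of x y] mixed[OF s, of x y] mixed[OF s, of y x] comm[of x y]
        by (cases "x \<in> H"; cases "y \<in> H") auto
      then show ?thesis
        using subgroup.subset[OF s] subgroup.one_closed[OF s] by (simp add: boolean_character_def)
    qed
  next
    assume b: "boolean_character H G"
    then have Hc: "H \<subseteq> carrier G" and o: "\<one>\<^bsub>G\<^esub> \<in> H"
      and c: "\<And>x y. x \<in> carrier G \<Longrightarrow> y \<in> carrier G \<Longrightarrow> x \<otimes>\<^bsub>G\<^esub> y \<in> H \<longleftrightarrow> (x \<in> H \<longleftrightarrow> y \<in> H)"
      by (auto simp: boolean_character_def)
    have s: "subgroup H G" by (rule subI[OF Hc o]) (use c Hc in auto)
    have "K = H \<or> K = carrier G" if K: "subgroup K G" "H \<subseteq> K" for K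
    proof (cases "K = H")
      case False
      then obtain k where k: "k \<in> K" "k \<notin> H" using K(2) by auto
      have kc: "k \<in> carrier G" by (rule subgroup.mem_carrier[OF K(1) k(1)])
      have "y \<in> K" if y: "y \<in> carrier G" for y
      proof (rule ccontr)
        assume n: "y \<notin> K"
        then have "k \<otimes>\<^bsub>G\<^esub> y \<in> K" using c[OF kc y] k(2) K(2) by auto
        then show False using mixed[OF K(1) k(1) y n] by simp
      qed
      then show ?thesis using subgroup.subset[OF K(1)] by auto
    qed simp
    then show "H = carrier G \<or> hyperplane H G" using s by (auto simp: hyperplane_def)
  qed
qed


section \<open>Hereditary sets\<close>

context strongly_fregean_algebra
begin

lemma hereditary_iff:
  "hereditary ar A Z \<longleftrightarrow> Z \<in> Up_Cm ar A \<and>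
     (\<forall>\<eta>\<in>Cm ar A. above_class ar A \<eta> \<subseteq> Z \<longrightarrow>
        boolean_character (bar ar A \<eta> (Z \<inter> sim_class ar A \<eta>)) (bar_group ar A \<eta>))"
proof -
  have "bar ar A \<eta> (sim_class ar A \<eta>) = carrier (bar_group ar A \<eta>)" for \<eta>
    by (simp add: bar_group_def)
  then show ?thesis
    unfolding hereditary_def using boolean_character_iff[OF bar_group_Boolean] by auto
qed

text \<open>
  Elements strictly above a member of the class of \<open>\<eta>\<close> lie above \<open>\<eta>\<^sup>+\<close>, where \<open>S\<close> and \<open>T\<close> agree by
  assumption. On the class itself \<open>S \<leftrightarrow> T\<close> is therefore the pointwise equivalence of \<open>S\<close> and \<open>T\<close>, which
  is the sum of the two characters.
\<close>

lemma hereditary_heyting_equiv: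
  assumes S: "hereditary ar A S" and T: "hereditary ar A T"
  shows "hereditary ar A (heyting_equiv ar A S T)"
  unfolding hereditary_iff
proof (intro conjI ballI impI)
  let ?C = "heyting_equiv ar A S T"
  have C_iff: "\<mu> \<in> ?C \<longleftrightarrow> \<mu> \<in> Cm ar A \<and> (\<forall>\<psi>. \<mu> \<subseteq> \<psi> \<longrightarrow> (\<psi> \<in> S \<longleftrightarrow> \<psi> \<in> T))" for \<mu>
    unfolding heyting_equiv_def down_def by auto
  have up: "\<And>\<phi> \<psi>. \<phi> \<in> S \<Longrightarrow> \<psi> \<in> Cm ar A \<Longrightarrow> \<phi> \<subseteq> \<psi> \<Longrightarrow> \<psi> \<in> S"
    "\<And>\<phi> \<psi>. \<phi> \<in> T \<Longrightarrow> \<psi> \<in> Cm ar A \<Longrightarrow> \<phi> \<subseteq> \<psi> \<Longrightarrow> \<psi> \<in> T"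
    and Cm: "S \<subseteq> Cm ar A" "T \<subseteq> Cm ar A"
    using S T unfolding hereditary_def Up_Cm_def by auto
  show "?C \<in> Up_Cm ar A" unfolding Up_Cm_def using C_iff by auto

  fix \<eta> assume \<eta>: "\<eta> \<in> Cm ar A" and above: "above_class ar A \<eta> \<subseteq> ?C"
  let ?G = "bar_group ar A \<eta>" and ?U = "sim_class ar A \<eta>"
  let ?B = "\<lambda>Z. bar ar A \<eta> (Z \<inter> ?U)"
  have agree: "\<theta> \<in> S \<longleftrightarrow> \<theta> \<in> T" if "\<theta> \<in> above_class ar A \<eta>" for \<theta>
    using that above C_iff[of \<theta>] by auto
  have C_U: "\<mu> \<in> ?C \<longleftrightarrow> (\<mu> \<in> S \<longleftrightarrow> \<mu> \<in> T)" if \<mu>: "\<mu> \<in> ?U" for \<mu>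
  proof -
    note D = sim_classD[OF \<mu>]
    have "\<psi> \<in> S \<longleftrightarrow> \<psi> \<in> T" if "\<mu> \<subset> \<psi>" for \<psi>
    proof (cases "\<psi> \<in> Cm ar A")
      case True
      then have "\<psi> \<in> above_class ar A \<eta>"
        using cover_props(3)[OF D(3) Cm_Con[OF True] that] D(4) by (simp add: above_class_def)
      then show ?thesis by (rule agree)
    qed (use Cm in auto)
    then show ?thesis unfolding C_iff using D(3) by auto
  qed
  show "boolean_character (?B ?C) ?G"
  proof (cases "above_class ar A \<eta> \<subseteq> S")
    case True
    then have aT: "above_class ar A \<eta> \<subseteq> T" using agree by auto
    have ch: "boolean_character (?B S) ?G" "boolean_character (?B T) ?G"
      using S T True aT \<eta> unfolding hereditary_iff by auto
    have cG: "carrier ?G = ?U \<union> {cover \<eta>}" "\<one>\<^bsub>?G\<^esub> = cover \<eta>"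
      by (simp_all add: bar_group_def bar_def)
    have B: "x \<in> ?B ?C \<longleftrightarrow> (x \<in> ?B S \<longleftrightarrow> x \<in> ?B T)" if "x \<in> carrier ?G" for x
      using that C_U[of x] unfolding cG bar_def by auto
    interpret G: group ?G by (rule bar_group_Boolean(1)[OF \<eta>])
    show ?thesis
      unfolding boolean_character_def
    proof (intro conjI ballI)
      show "?B ?C \<subseteq> carrier ?G" "\<one>\<^bsub>?G\<^esub> \<in> ?B ?C" unfolding cG bar_def by auto
      fix x y assume xy: "x \<in> carrier ?G" "y \<in> carrier ?G"
      show "x \<otimes>\<^bsub>?G\<^esub> y \<in> ?B ?C \<longleftrightarrow> (x \<in> ?B ?C \<longleftrightarrow> y \<in> ?B ?C)"
        using ch xy unfolding boolean_character_def B[OF xy(1)] B[OF xy(2)] B[OF G.m_closed[OF xy]]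
        by blast
    qed
  next
    case False
    then obtain \<theta> where th: "\<theta> \<in> above_class ar A \<eta>" "\<theta> \<notin> S" by auto
    then have "\<theta> \<notin> T" using agree by auto
    have none: "\<mu> \<notin> S" "\<mu> \<notin> T" if "\<mu> \<in> ?U" for \<mu>
      using up[of \<mu> \<theta>] th \<open>\<theta> \<notin> T\<close> sim_classD(5)[OF that] by (auto simp: above_class_def)
    then have "?C \<inter> ?U = ?U" using C_U by auto
    then have "?B ?C = carrier ?G" by (simp add: bar_group_def)
    then show ?thesis
      using boolean_character_iff[OF bar_group_Boolean[OF \<eta>]] by auto
  qed
qed

end

theorem theorem28:
  fixes ar :: "'f \<Rightarrow> nat" and A :: "('f, 'a) ualg" and t :: "('f, nat) trm"
  assumes "is_algebra ar A"
    and "constant_trm ar A t"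
    and "strongly_fregean ar t A"
  shows "\<forall>S\<in>hereditary_sets ar A. \<forall>T\<in>hereditary_sets ar A.
           heyting_equiv ar A S T \<in> hereditary_sets ar A"
proof -
  interpret strongly_fregean_algebra ar A t
    using assms by unfold_locales
  show ?thesis using hereditary_heyting_equiv by (simp add: hereditary_sets_def)
qed


end
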